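(* If $G$ is an outerplanar graph, then $$\tau_2(G)\le \left\lfloor\sqrt{2\Delta(G)+4.25}+5.5\right\rfloor\le \left\lfloor\sqrt{2\Delta(G)}+6.6\right\rfloor.$$
   Context: All graphs are finite and simple. $\Delta(G)$ denotes the maximum degree of $G$. $[k]=\{1,\dots,k\}$ and $\binom{[k]}{t}$ is the collection of all $t$-element subsets of $[k]$. $d(v,w)$ is the distance (length of the shortest path) between $v$ and $w$. For a graph $G$ and positive integers $t,k$, a $t$-tone $k$-coloring of $G$ is a function $f:V(G)\to\binom{[k]}{t}$ such that $|f(v)\cap f(w)|<d(v,w)$ for all distinct $v,w\in V(G)$. The $t$-tone chromatic number $\tau_t(G)$ is the minimum $k$ such that $G$ has a $t$-tone $k$-coloring.
   Formalization: The second inequality is stated only for Δ(G) ≥ 1, since for Δ(G) = 0 it would read 7 ≤ 6; both upper bounds on τ_2(G) are proved for every outerplanar graph, edgeless ones included. *)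

theory Defs
  imports "HOL-Analysis.Analysis" "HOL-Library.Extended_Nat"
begin

definition finite_simple_graph :: "'a set \<Rightarrow> 'a set set \<Rightarrow> bool" where
  "finite_simple_graph V E \<longleftrightarrow> finite V \<and> (\<forall>e\<in>E. e \<subseteq> V \<and> card e = 2)"

definition vdegree :: "'a set set \<Rightarrow> 'a \<Rightarrow> nat" where
  "vdegree E v = card {e \<in> E. v \<in> e}"

text \<open>Inserting 0 only matters for the graph without vertices.\<close>

definition max_degree :: "'a set \<Rightarrow> 'a set set \<Rightarrow> nat" where
  "max_degree V E = Max (insert 0 (vdegree E ` V))"

definition graph_path :: "'a set \<Rightarrow> 'a set set \<Rightarrow> 'a \<Rightarrow> 'a list \<Rightarrow> 'a \<Rightarrow> bool" where
  "graph_path V E v xs w \<longleftrightarrow>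
     xs \<noteq> [] \<and> hd xs = v \<and> last xs = w \<and> set xs \<subseteq> V \<and> distinct xs \<and>
     successively (\<lambda>x y. {x, y} \<in> E) xs"

text \<open>The length of a path is its number of edges. The infimum of the empty set is
  \<open>\<infinity>\<close>, the distance between vertices in different components.\<close>

definition graph_dist :: "'a set \<Rightarrow> 'a set set \<Rightarrow> 'a \<Rightarrow> 'a \<Rightarrow> enat" where
  "graph_dist V E v w = (INF xs \<in> {xs. graph_path V E v xs w}. enat (length xs - 1))"

definition tone_coloring ::
    "nat \<Rightarrow> nat \<Rightarrow> 'a set \<Rightarrow> 'a set set \<Rightarrow> ('a \<Rightarrow> nat set) \<Rightarrow> bool" where
  "tone_coloring t k V E f \<longleftrightarrow>
     (\<forall>v\<in>V. f v \<subseteq> {1..k} \<and> card (f v) = t) \<and>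
     (\<forall>v\<in>V. \<forall>w\<in>V. v \<noteq> w \<longrightarrow> enat (card (f v \<inter> f w)) < graph_dist V E v w)"

definition tone_chromatic_number :: "nat \<Rightarrow> 'a set \<Rightarrow> 'a set set \<Rightarrow> nat" where
  "tone_chromatic_number t V E = (LEAST k. k > 0 \<and> (\<exists>f. tone_coloring t k V E f))"

text \<open>A plane drawing sends the vertices to distinct points and every edge to an arc
  between the images of its ends. An arc contains no other vertex, and two arcs meet
  only in the images of common ends.\<close>

definition plane_drawing ::
    "'a set \<Rightarrow> 'a set set \<Rightarrow> ('a \<Rightarrow> complex) \<Rightarrow> ('a set \<Rightarrow> real \<Rightarrow> complex) \<Rightarrow> bool" where
  "plane_drawing V E p g \<longleftrightarrow>
     inj_on p V \<and>
     (\<forall>e\<in>E. arc (g e) \<and> {pathstart (g e), pathfinish (g e)} = p ` e \<and>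
             path_image (g e) \<inter> p ` V = p ` e) \<and>
     (\<forall>e\<in>E. \<forall>e'\<in>E. e \<noteq> e' \<longrightarrow> path_image (g e) \<inter> path_image (g e') = p ` (e \<inter> e'))"

definition drawing_image ::
    "'a set \<Rightarrow> 'a set set \<Rightarrow> ('a \<Rightarrow> complex) \<Rightarrow> ('a set \<Rightarrow> real \<Rightarrow> complex) \<Rightarrow> complex set" where
  "drawing_image V E p g = p ` V \<union> (\<Union>e\<in>E. path_image (g e))"

text \<open>The set \<open>outside D\<close> is the unbounded face of a drawing with image \<open>D\<close>, as \<open>D\<close> is compact.\<close>

definition outerplanar :: "'a set \<Rightarrow> 'a set set \<Rightarrow> bool" where
  "outerplanar V E \<longleftrightarrow>
     (\<exists>p g. plane_drawing V E p g \<and> p ` V \<subseteq> frontier (outside (drawing_image V E p g)))"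

end

theory Submission
  imports Defs
begin

text \<open>A 2-tone colouring gives disjoint pairs of colours to adjacent vertices and different pairs to
  vertices at distance 2; larger distances impose nothing. The number \<open>k\<close> of colours in the theorem
  satisfies \<open>(k - 4 choose 2) \<ge> \<Delta> + 3\<close>, and with this many colours an induction on the number of
  vertices succeeds. A vertex of degree at most 1 is deleted and coloured last. Otherwise there is a
  vertex \<open>v\<close> of degree 2 with a neighbour of degree at most 4. It is smoothed away: \<open>v\<close> is deleted
  and its neighbours are joined, which keeps the graph outerplanar and increases no degree. To
  colour \<open>v\<close>, at most 4 colours on its neighbours and at most \<open>3 + (\<Delta> - 1)\<close> pairs on the vertices
  at distance 2 are forbidden, so one of the \<open>(k - 4 choose 2)\<close> pairs is left
  (\<open>minor_free_pair_coloring\<close>).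

  The vertex \<open>v\<close> comes from \<open>degree_two_vertex_with_light_neighbour\<close>. If it did not exist, one could
  smooth away all vertices of degree 2 at once; the smoothed graph is again outerplanar, and it has a
  vertex \<open>u\<close> of degree at most 2 (\<open>low_noncut_vertex\<close>, by breadth-first search). If \<open>u\<close> has no
  smoothed neighbour, its degree has not changed, so it is a vertex of degree 2 that should have
  been smoothed away itself. Otherwise its original degree is at least 5, but turns out to be at
  most 4.

  These arguments use outerplanarity only through the absence of \<open>K\<^sub>2\<^sub>,\<^sub>3\<close> and \<open>K\<^sub>4\<close> minors
  (\<open>outerplanar_minor_free\<close>), a property that deletions and contractions preserve. Its
  proof from a plane drawing with all vertices on the frontier of the unbounded face rests on two
  facts about arcs in the plane. Let three arcs have common ends and be otherwise disjoint. By the Jordan curve theorem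
  and Janiszewski's theorem, one of the arcs meets the inside of the closed curve formed by the
  other two (\<open>theta_arc_meets_inside\<close>). No vertex on the outer frontier lies inside a closed curve of
  the drawing, so the three arcs cannot all have inner vertices; this rules out \<open>K\<^sub>2\<^sub>,\<^sub>3\<close>. For \<open>K\<^sub>4\<close>,
  both chords of a closed curve through the four branch vertices must run inside it, and there they
  would cross (\<open>no_crossing_chords\<close>).\<close>

section \<open>Theta graphs in the plane\<close>

lemma Jordan_two_arcs:
  fixes c1 c2 :: "real \<Rightarrow> complex"
  assumes "arc c1" "pathstart c1 = a" "pathfinish c1 = b"
    and "arc c2" "pathstart c2 = a" "pathfinish c2 = b"
    and "path_image c1 \<inter> path_image c2 = {a, b}"
  defines "J \<equiv> path_image c1 \<union> path_image c2"
  shows "inside J \<noteq> {}" "open (inside J)" "connected (inside J)" "frontier (inside J) = J"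
    "connected (outside J)" "compact J"
proof -
  let ?c = "c1 +++ reversepath c2"
  have "simple_path ?c"
    by (rule simple_path_join_loop) (use assms in \<open>auto simp: arc_reversepath\<close>)
  moreover have "pathfinish ?c = pathstart ?c" using assms by simp
  moreover have "path_image ?c = J" using assms by (simp add: path_image_join J_def)
  ultimately show "inside J \<noteq> {}" "open (inside J)" "connected (inside J)" "frontier (inside J) = J"
    "connected (outside J)"
    using Jordan_inside_outside[of ?c] by metis+
  show "compact J" using assms by (simp add: J_def compact_arc_image compact_Un)
qed

text \<open>If none of the three arcs met the inside of the closed curve formed by the other two, the
  three insides would be pairwise disjoint. Janiszewski's theorem, applied to the closed curves
  that share \<open>c1\<close>, shows that a point outside of both of them lies outside of the whole theta
  graph. The inside of the third closed curve consists of such points, which is absurd.\<close>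

lemma theta_arc_meets_inside:
  fixes c1 c2 c3 :: "real \<Rightarrow> complex"
  assumes c1: "arc c1" "pathstart c1 = a" "pathfinish c1 = b"
    and c2: "arc c2" "pathstart c2 = a" "pathfinish c2 = b"
    and c3: "arc c3" "pathstart c3 = a" "pathfinish c3 = b"
    and c12: "path_image c1 \<inter> path_image c2 = {a, b}"
    and c13: "path_image c1 \<inter> path_image c3 = {a, b}"
    and c23: "path_image c2 \<inter> path_image c3 = {a, b}"
  shows "path_image c1 \<inter> inside (path_image c2 \<union> path_image c3) \<noteq> {} \<or>
    path_image c2 \<inter> inside (path_image c1 \<union> path_image c3) \<noteq> {} \<or>
    path_image c3 \<inter> inside (path_image c1 \<union> path_image c2) \<noteq> {}"
proof (rule ccontr)
  assume contra: "\<not> ?thesis"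
  define A1 A2 A3 where A: "A1 = path_image c1" "A2 = path_image c2" "A3 = path_image c3"
  define T where "T = A1 \<union> A2 \<union> A3"
  note J12 = Jordan_two_arcs[OF c1 c2 c12, folded A]
  note J13 = Jordan_two_arcs[OF c1 c3 c13, folded A]
  note J23 = Jordan_two_arcs[OF c2 c3 c23, folded A]
  have disj: "A1 \<inter> inside (A2 \<union> A3) = {}" "A2 \<inter> inside (A1 \<union> A3) = {}" "A3 \<inter> inside (A1 \<union> A2) = {}"
    using contra by (auto simp: A)
  have no: "I \<inter> T = {}" if "I = inside (A1 \<union> A2) \<or> I = inside (A1 \<union> A3) \<or> I = inside (A2 \<union> A3)" for I
    using that disj inside_no_overlap[of "A1 \<union> A2"] inside_no_overlap[of "A1 \<union> A3"]
      inside_no_overlap[of "A2 \<union> A3"] unfolding T_def by blast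
  \<comment> \<open>Two of the insides cannot meet: connectedness would make them equal, and then their
    frontiers, so that one arc would lie in the union of the other two.\<close>
  have sub: "I \<subseteq> I'" if "connected I" "I \<inter> I' \<noteq> {}" "I \<inter> frontier I' = {}" for I I' :: "complex set"
    using connected_Int_frontier[of I I'] that by blast
  have eq: "I = I'" if "connected I" "connected I'" "I \<inter> T = {}" "I' \<inter> T = {}" "frontier I \<subseteq> T"
    "frontier I' \<subseteq> T" "I \<inter> I' \<noteq> {}" for I I'
  proof
    show "I \<subseteq> I'" using sub[of I I'] that by blast
    show "I' \<subseteq> I" using sub[of I' I] that by blast
  qed
  have endless: "path_image c - {a, b} \<noteq> {}" if "arc c" "pathstart c = a" "pathfinish c = b" for c
    using nonempty_simple_path_endless[of c] arc_imp_simple_path[of c] that by auto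
  have d12: "inside (A1 \<union> A2) \<inter> inside (A2 \<union> A3) = {}"
  proof (rule ccontr)
    assume "\<not> ?thesis"
    then have "inside (A1 \<union> A2) = inside (A2 \<union> A3)"
      using eq[of "inside (A1 \<union> A2)" "inside (A2 \<union> A3)"] no J12 J23 by (auto simp: T_def)
    then have "A1 \<union> A2 = A2 \<union> A3" using J12(4) J23(4) by metis
    then show False using endless[OF c1] c12 c13 unfolding A by blast
  qed
  have d13: "inside (A1 \<union> A3) \<inter> inside (A2 \<union> A3) = {}"
  proof (rule ccontr)
    assume "\<not> ?thesis"
    then have "inside (A1 \<union> A3) = inside (A2 \<union> A3)"
      using eq[of "inside (A1 \<union> A3)" "inside (A2 \<union> A3)"] no J13 J23 by (auto simp: T_def)
    then have "A1 \<union> A3 = A2 \<union> A3" using J13(4) J23(4) by metis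
    then show False using endless[OF c1] c12 c13 unfolding A by blast
  qed
  obtain y where y: "y \<in> inside (A2 \<union> A3)" using J23(1) by auto
  then have y': "y \<in> outside (A1 \<union> A2)" "y \<in> outside (A1 \<union> A3)"
    using d12 d13 no[of "inside (A2 \<union> A3)"] inside_Un_outside[of "A1 \<union> A2"]
      inside_Un_outside[of "A1 \<union> A3"] unfolding T_def by blast+
  have "bounded T" unfolding T_def using J12(6) J13(6) by (auto dest!: compact_imp_bounded)
  then obtain z where z: "z \<in> outside T" using outside_bounded_nonempty by blast
  then have z': "z \<in> outside (A1 \<union> A2)" "z \<in> outside (A1 \<union> A3)"
    using outside_mono[of "A1 \<union> A2" T] outside_mono[of "A1 \<union> A3" T] unfolding T_def by blast+
  have "connected_component (- ((A1 \<union> A2) \<union> (A1 \<union> A3))) y z"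
  proof (rule Janiszewski)
    show "compact (A1 \<union> A2)" "closed (A1 \<union> A3)" using J12 J13 by (auto simp: compact_imp_closed)
    have "(A1 \<union> A2) \<inter> (A1 \<union> A3) = A1" using c23 c12 unfolding A by blast
    then show "connected ((A1 \<union> A2) \<inter> (A1 \<union> A3))" using c1 by (simp add: A connected_arc_image)
    show "connected_component (- (A1 \<union> A2)) y z" unfolding connected_component_def
      using J12(5) y' z' outside_no_overlap[of "A1 \<union> A2"]
      by (intro exI[of _ "outside (A1 \<union> A2)"]) blast
    show "connected_component (- (A1 \<union> A3)) y z" unfolding connected_component_def
      using J13(5) y' z' outside_no_overlap[of "A1 \<union> A3"]
      by (intro exI[of _ "outside (A1 \<union> A3)"]) blast
  qed
  moreover have "(A1 \<union> A2) \<union> (A1 \<union> A3) = T" by (auto simp: T_def)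
  ultimately have "y \<in> outside T"
    using z outside_same_component connected_component_sym by metis
  then have "y \<in> outside (A2 \<union> A3)" using outside_mono[of "A2 \<union> A3" T] by (auto simp: T_def)
  then show False using y inside_Int_outside by blast
qed

lemma frontier_outside_not_inside:
  fixes D :: "complex set"
  assumes "z \<in> frontier (outside D)" "J \<subseteq> D" "closed J"
  shows "z \<notin> inside J"
proof
  assume z: "z \<in> inside J"
  have "z \<in> closure (outside J)"
    using assms(1,2) closure_mono[OF outside_mono[OF assms(2)]] by (auto simp: frontier_def)
  moreover have "open (inside J)" using assms(3) by (simp add: open_inside)
  ultimately have "inside J \<inter> outside J \<noteq> {}"
    using z open_Int_closure_eq_empty by blast
  then show False by simp
qed

text \<open>An arc of a theta graph without its ends is connected, so it lies entirely inside or entirely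
  outside the closed curve formed by the other two arcs. Inside is impossible if one of its points
  is on the outer frontier.\<close>

lemma arc_avoids_inside:
  fixes c :: "real \<Rightarrow> complex"
  assumes c: "arc c" "pathstart c = a" "pathfinish c = b"
    and c1: "arc c1" "pathstart c1 = a" "pathfinish c1 = b"
    and c2: "arc c2" "pathstart c2 = a" "pathfinish c2 = b"
    and c12: "path_image c1 \<inter> path_image c2 = {a, b}"
    and cc: "path_image c \<inter> path_image c1 = {a, b}" "path_image c \<inter> path_image c2 = {a, b}"
    and x: "x \<in> path_image c" "x \<noteq> a" "x \<noteq> b" "x \<in> frontier (outside D)"
    and sub: "path_image c1 \<union> path_image c2 \<subseteq> D"
  shows "path_image c \<inter> inside (path_image c1 \<union> path_image c2) = {}"
proof (rule ccontr)
  let ?J = "path_image c1 \<union> path_image c2"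
  assume "\<not> ?thesis"
  then obtain y where y: "y \<in> path_image c" "y \<in> inside ?J" by blast
  note J = Jordan_two_arcs[OF c1 c2 c12]
  have "y \<notin> ?J" using y(2) inside_no_overlap by blast
  then have yC: "y \<in> path_image c - {a, b}" using y c12 by blast
  have "connected (path_image c - {a, b})"
    using connected_simple_path_endless[of c] c arc_imp_simple_path by metis
  moreover have "(path_image c - {a, b}) \<inter> frontier (inside ?J) = {}" using J(4) cc by blast
  ultimately have "path_image c - {a, b} \<subseteq> inside ?J"
    using connected_Int_frontier[of "path_image c - {a,b}" "inside ?J"] yC y by blast
  then have "x \<in> inside ?J" using x by blast
  moreover have "closed ?J" using J(6) by (rule compact_imp_closed)
  ultimately show False using frontier_outside_not_inside[OF x(4) sub] by blast
qed

text \<open>The topological reason for the absence of a subdivision of \<open>K\<^sub>4\<close>: two chords of a closed curve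
  whose ends alternate cannot both run inside it without crossing. The ends \<open>a\<close> and \<open>b\<close> of the chord
  \<open>c\<close> split the closed curve into \<open>c1\<close> and \<open>c2\<close>; the chord \<open>e\<close> joins a point of \<open>c1\<close> to a point
  of \<open>c2\<close>. That \<open>c\<close> runs inside the closed curve follows from the position of \<open>x1\<close> and \<open>x2\<close> on
  the outer frontier.\<close>

lemma no_crossing_chords:
  fixes c1 c2 c e :: "real \<Rightarrow> complex"
  assumes c1: "arc c1" "pathstart c1 = a" "pathfinish c1 = b"
    and c2: "arc c2" "pathstart c2 = a" "pathfinish c2 = b"
    and c: "arc c" "pathstart c = a" "pathfinish c = b"
    and c12: "path_image c1 \<inter> path_image c2 = {a, b}"
    and c1c: "path_image c1 \<inter> path_image c = {a, b}"
    and c2c: "path_image c2 \<inter> path_image c = {a, b}"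
    and x1: "x1 \<in> path_image c1 - {a, b}" "x1 \<in> frontier (outside D)"
    and x2: "x2 \<in> path_image c2 - {a, b}" "x2 \<in> frontier (outside D)"
    and sub: "path_image c1 \<union> path_image c2 \<union> path_image c \<subseteq> D"
    and e: "arc e" "pathstart e = x1" "pathfinish e = x2"
    and ec: "path_image e \<inter> path_image c = {}"
    and eJ: "path_image e \<inter> (path_image c1 \<union> path_image c2) \<subseteq> {x1, x2}"
    and ein: "path_image e \<inter> inside (path_image c1 \<union> path_image c2) \<noteq> {}"
  shows False
proof -
  let ?J = "path_image c1 \<union> path_image c2"
  have abne: "a \<noteq> b" using c1 arc_distinct_ends by metis
  have n1: "path_image c1 \<inter> inside (path_image c2 \<union> path_image c) = {}"
    by (rule arc_avoids_inside[OF c1 c2 c c2c c12 c1c]) (use x1 sub in auto)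
  have n2: "path_image c2 \<inter> inside (path_image c1 \<union> path_image c) = {}"
    by (rule arc_avoids_inside[OF c2 c1 c c1c _ c2c]) (use c12 x2 sub in auto)
  have ne: "path_image c \<inter> inside ?J \<noteq> {}"
    using theta_arc_meets_inside[OF c1 c2 c c12 c1c c2c] n1 n2 by blast
  note sp = c1(1)[THEN arc_imp_simple_path] c2(1)[THEN arc_imp_simple_path] c(1)[THEN arc_imp_simple_path]
  from split_inside_simple_closed_curve[OF sp(1) c1(2,3) sp(2) c2(2,3) sp(3) c(2,3) abne c12 c1c c2c ne]
  have I: "inside (path_image c1 \<union> path_image c) \<inter> inside (path_image c2 \<union> path_image c) = {}"
    "inside (path_image c1 \<union> path_image c) \<union> inside (path_image c2 \<union> path_image c) \<union>
           (path_image c - {a,b}) = inside ?J" by blast+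
  let ?I1 = "inside (path_image c1 \<union> path_image c)" and ?I2 = "inside (path_image c2 \<union> path_image c)"
  note J = Jordan_two_arcs[OF c1 c2 c12]
  note J1 = Jordan_two_arcs[OF c1 c c1c]
  note J2 = Jordan_two_arcs[OF c2 c c2c]
  let ?e = "path_image e - {x1, x2}"
  have con: "connected ?e" using connected_simple_path_endless[of e] e arc_imp_simple_path by metis
  have x12: "x1 \<in> path_image e" "x2 \<in> path_image e" using e pathstart_in_path_image pathfinish_in_path_image by metis+
  have clo: "path_image e \<subseteq> closure ?e"
  proof
    fix x assume x: "x \<in> path_image e"
    have "connected (path_image e)" using e by (simp add: connected_arc_image)
    moreover have "x1 \<noteq> x2" using e arc_distinct_ends by metis
    then have "\<nexists>y. path_image e = {y}" using x12 by auto
    ultimately have "x islimpt path_image e" using x connected_imp_perfect by blast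
    moreover have "path_image e = insert x1 (insert x2 ?e)" using x12 by blast
    ultimately have "x islimpt ?e" using islimpt_insert by metis
    then show "x \<in> closure ?e" by (simp add: closure_def)
  qed
  have "?e \<inter> frontier (inside ?J) = {}" using J(4) eJ by blast
  moreover have "?e \<inter> inside ?J \<noteq> {}"
    using ein x1 x2 inside_no_overlap[of ?J] by blast
  ultimately have "?e \<subseteq> inside ?J" using connected_Int_frontier[OF con] by blast
  \<comment> \<open>The chord \<open>c\<close> cuts the inside into two open parts, and \<open>e\<close> stays in one of them. The closure
    of either part misses an end of \<open>e\<close>.\<close>
  then have sub12: "?e \<subseteq> ?I1 \<union> ?I2" using I(2) ec by blast
  have split: "?e \<subseteq> ?I1 \<or> ?e \<subseteq> ?I2"
  proof (rule ccontr)
    assume "\<not> ?thesis"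
    then have "?I1 \<inter> ?e \<noteq> {}" "?I2 \<inter> ?e \<noteq> {}" using sub12 by blast+
    then show False using connectedD[OF con J1(2) J2(2) _ sub12] I(1) by blast
  qed
  have "x2 \<notin> ?I1" "x1 \<notin> ?I2"
    using frontier_outside_not_inside[OF x2(2), of "path_image c1 \<union> path_image c"]
      frontier_outside_not_inside[OF x1(2), of "path_image c2 \<union> path_image c"] J1(6) J2(6) sub
    by (auto simp: compact_imp_closed)
  moreover have "x2 \<notin> path_image c1 \<union> path_image c" "x1 \<notin> path_image c2 \<union> path_image c"
    using x1 x2 c12 c1c c2c by blast+
  moreover have "closure ?I1 = ?I1 \<union> (path_image c1 \<union> path_image c)"
    "closure ?I2 = ?I2 \<union> (path_image c2 \<union> path_image c)"
    using J1(4) J2(4) closure_Un_frontier by metis+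
  ultimately have "x2 \<notin> closure ?I1" "x1 \<notin> closure ?I2" by blast+
  then show False using split clo x12 closure_mono by blast
qed

section \<open>Paths as lists\<close>

text \<open>The edges that a list of vertices traverses.\<close>

fun ledges :: "'a list \<Rightarrow> 'a set set" where
  "ledges (x # y # ys) = insert {x, y} (ledges (y # ys))"
| "ledges _ = {}"

lemma successively_iff_ledges: "successively (\<lambda>x y. {x, y} \<in> E) xs \<longleftrightarrow> ledges xs \<subseteq> E"
  by (induction xs rule: ledges.induct) auto

lemma ledges_subset_set: "e \<in> ledges xs \<Longrightarrow> e \<subseteq> set xs"
  by (induction xs rule: ledges.induct) auto

lemma ledges_append_tl:
  assumes "xs \<noteq> []" "ys \<noteq> []" "last xs = hd ys"
  shows "ledges (xs @ tl ys) = ledges xs \<union> ledges ys"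
  using assms
proof (induction xs rule: ledges.induct)
  case ("2_2" v)
  then show ?case by (cases ys) auto
qed auto

lemma ledges_append:
  assumes "xs \<noteq> []" "ys \<noteq> []"
  shows "ledges (xs @ ys) = insert {last xs, hd ys} (ledges xs \<union> ledges ys)"
  using assms
proof (induction xs rule: ledges.induct)
  case ("2_2" v)
  then show ?case by (cases ys) auto
qed auto

lemma ledges_rev: "ledges (rev xs) = ledges xs"
proof (induction xs rule: ledges.induct)
  case (1 x y ys)
  have "ledges (rev (x # y # ys)) = insert {last (rev (y # ys)), hd [x]} (ledges (rev (y # ys)) \<union> ledges [x])"
    using ledges_append[of "rev (y # ys)" "[x]"] by simp
  then show ?case using 1 by (auto simp: insert_commute)
qed auto

lemma ends_notin_ledges:
  assumes "distinct xs" "length xs \<ge> 3"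
  shows "{hd xs, last xs} \<notin> ledges xs"
proof -
  obtain x y zs where xs: "xs = x # y # zs" "zs \<noteq> []"
    using assms(2) by (cases xs; cases "tl xs"; cases "tl (tl xs)") auto
  have "last zs \<noteq> y" "last zs \<noteq> x" using assms(1) xs last_in_set[of zs] by auto
  then have "{x, last zs} \<noteq> {x, y}" by (auto simp: doubleton_eq_iff)
  moreover have "{x, last zs} \<notin> ledges (y # zs)"
    using ledges_subset_set[of "{x, last zs}" "y # zs"] assms(1) xs by auto
  ultimately show ?thesis using xs by simp
qed

lemma graph_pathD:
  assumes "graph_path V E a xs b"
  shows "xs \<noteq> []" "hd xs = a" "last xs = b" "set xs \<subseteq> V" "distinct xs" "ledges xs \<subseteq> E"
    "a \<in> set xs" "b \<in> set xs"
  using assms by (auto simp: graph_path_def successively_iff_ledges)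

lemma graph_path_iff:
  "graph_path V E a xs b \<longleftrightarrow>
    xs \<noteq> [] \<and> hd xs = a \<and> last xs = b \<and> set xs \<subseteq> V \<and> distinct xs \<and> ledges xs \<subseteq> E"
  by (auto simp: graph_path_def successively_iff_ledges)

lemma set_append_tl: "ys \<noteq> [] \<Longrightarrow> hd ys \<in> set xs \<Longrightarrow> set (xs @ tl ys) = set xs \<union> set ys"
  by (cases ys) auto

lemma graph_path_rev: "graph_path V E a xs b \<Longrightarrow> graph_path V E b (rev xs) a"
  by (simp add: graph_path_iff hd_rev last_rev ledges_rev)

lemma graph_path_join:
  assumes "graph_path V E a xs b" "graph_path V E b ys c" "set xs \<inter> set ys = {b}"
  shows "graph_path V E a (xs @ tl ys) c" "set (xs @ tl ys) = set xs \<union> set ys"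
    "ledges (xs @ tl ys) = ledges xs \<union> ledges ys"
proof -
  note x = graph_pathD[OF assms(1)] and y = graph_pathD[OF assms(2)]
  show s: "set (xs @ tl ys) = set xs \<union> set ys" using x y set_append_tl by metis
  show l: "ledges (xs @ tl ys) = ledges xs \<union> ledges ys" using x y ledges_append_tl by metis
  obtain zs where ys: "ys = b # zs" using y by (cases ys) auto
  have "last (xs @ zs) = c" using y x ys by (cases zs) auto
  moreover have "distinct (xs @ zs)" using x y ys assms(3) by auto
  ultimately show "graph_path V E a (xs @ tl ys) c"
    using x y s l by (simp add: graph_path_iff ys)
qed

section \<open>Subdivisions in a drawing with all vertices on the outer face\<close>

text \<open>A drawing of a graph that has all vertices on the frontier of the unbounded face.\<close>

locale outer_drawing =
  fixes V :: "'a set" and E :: "'a set set" and p :: "'a \<Rightarrow> complex" and g :: "'a set \<Rightarrow> real \<Rightarrow> complex"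
  assumes graph: "finite_simple_graph V E"
    and drawing: "plane_drawing V E p g"
    and outer: "p ` V \<subseteq> frontier (outside (drawing_image V E p g))"
begin

abbreviation (input) D :: "complex set" where "D \<equiv> drawing_image V E p g"

text \<open>The part of the plane that a walk occupies in the drawing.\<close>

definition trace :: "'a list \<Rightarrow> complex set" where
  "trace xs = p ` set xs \<union> (\<Union>e\<in>ledges xs. path_image (g e))"

lemma inj_p: "inj_on p V" using drawing by (simp add: plane_drawing_def)

lemma edge_vertex: "e \<in> E \<Longrightarrow> path_image (g e) \<inter> p ` V = p ` e"
  using drawing by (simp add: plane_drawing_def)

lemma edge_edge: "e \<in> E \<Longrightarrow> e' \<in> E \<Longrightarrow> e \<noteq> e' \<Longrightarrow> path_image (g e) \<inter> path_image (g e') = p ` (e \<inter> e')"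
  using drawing by (simp add: plane_drawing_def)

lemma edge_subset: "e \<in> E \<Longrightarrow> e \<subseteq> V" and card_edge: "e \<in> E \<Longrightarrow> card e = 2"
  using graph by (auto simp: finite_simple_graph_def)

lemma oriented_edge_arc:
  assumes "{x, y} \<in> E"
  shows "\<exists>c. arc c \<and> pathstart c = p x \<and> pathfinish c = p y \<and> path_image c = path_image (g {x, y})"
proof -
  have a: "arc (g {x, y})" "{pathstart (g {x, y}), pathfinish (g {x, y})} = {p x, p y}"
    using drawing assms unfolding plane_drawing_def by auto
  then consider "pathstart (g {x, y}) = p x" "pathfinish (g {x, y}) = p y" |
    "pathstart (g {x, y}) = p y" "pathfinish (g {x, y}) = p x" by (auto simp: doubleton_eq_iff)
  then show ?thesis
  proof cases
    case 1
    then show ?thesis using a by blast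
  next
    case 2
    then show ?thesis using a
      by (intro exI[of _ "reversepath (g {x, y})"]) (auto simp: arc_reversepath)
  qed
qed

text \<open>Walks without a common edge meet, in the drawing, only in their common vertices.\<close>

lemma trace_Int:
  assumes "set xs \<subseteq> V" "set ys \<subseteq> V" "ledges xs \<subseteq> E" "ledges ys \<subseteq> E" "ledges xs \<inter> ledges ys = {}"
  shows "trace xs \<inter> trace ys = p ` (set xs \<inter> set ys)"
proof
  have ve: "p x \<in> p ` (set us \<inter> set vs)"
    if "x \<in> set us" "set us \<subseteq> V" "e \<in> ledges vs" "ledges vs \<subseteq> E" "p x \<in> path_image (g e)" for x e us vs
  proof -
    have "p x \<in> p ` e" using edge_vertex[of e] that by blast
    then obtain x' where "x' \<in> e" "p x = p x'" by blast
    moreover have "x' \<in> V" using \<open>x' \<in> e\<close> edge_subset that by blast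
    ultimately have "x \<in> e" using inj_onD[OF inj_p, of x x'] that by auto
    then show ?thesis using that ledges_subset_set[of e vs] by blast
  qed
  show "trace xs \<inter> trace ys \<subseteq> p ` (set xs \<inter> set ys)"
  proof
    fix z assume "z \<in> trace xs \<inter> trace ys"
    then consider "z \<in> p ` set xs" "z \<in> p ` set ys"
      | e where "z \<in> p ` set xs" "e \<in> ledges ys" "z \<in> path_image (g e)"
      | e where "z \<in> p ` set ys" "e \<in> ledges xs" "z \<in> path_image (g e)"
      | e e' where "e \<in> ledges xs" "e' \<in> ledges ys" "z \<in> path_image (g e)" "z \<in> path_image (g e')"
      unfolding trace_def by blast
    then show "z \<in> p ` (set xs \<inter> set ys)"
    proof cases
      case 1
      then show ?thesis using inj_on_image_Int[OF inj_p assms(1,2)] by auto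
    next
      case 2
      then show ?thesis using ve[of _ xs e ys] assms by auto
    next
      case 3
      then show ?thesis using ve[of _ ys e xs] assms by (auto simp: Int_commute)
    next
      case 4
      then have "z \<in> p ` (e \<inter> e')" using edge_edge[of e e'] assms by blast
      then show ?thesis using 4 ledges_subset_set[of e xs] ledges_subset_set[of e' ys] by blast
    qed
  qed
  show "p ` (set xs \<inter> set ys) \<subseteq> trace xs \<inter> trace ys" unfolding trace_def by blast
qed

lemma path_arc:
  assumes "graph_path V E a xs b" "a \<noteq> b"
  shows "\<exists>c. arc c \<and> pathstart c = p a \<and> pathfinish c = p b \<and> path_image c = trace xs"
  using assms
proof (induction xs arbitrary: a rule: ledges.induct)
  case (1 x y ys)
  from 1(2) have ax: "a = x" and e: "{x, y} \<in> E" and P: "graph_path V E y (y # ys) b"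
    and xn: "x \<notin> set (y # ys)"
    by (auto simp: graph_path_iff)
  obtain d where d: "arc d" "pathstart d = p x" "pathfinish d = p y" "path_image d = path_image (g {x, y})"
    using oriented_edge_arc[OF e] by blast
  have pxy: "p x \<in> path_image (g {x, y})" "p y \<in> path_image (g {x, y})"
    using d pathstart_in_path_image pathfinish_in_path_image by metis+
  show ?case
  proof (cases "y = b")
    case True
    then have "last (y # ys) = y" "y \<notin> set ys" using P by (auto simp: graph_path_iff)
    then have "ys = []" using last_in_set[of ys] by (cases "ys = []") auto
    then have "trace (x # y # ys) = path_image d" using pxy by (auto simp: trace_def d)
    then show ?thesis using d True ax by auto
  next
    case False
    obtain c where c: "arc c" "pathstart c = p y" "pathfinish c = p b" "path_image c = trace (y # ys)"
      using 1(1)[OF P False] by blast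
    have "path_image d = trace [x, y]" using pxy by (auto simp: trace_def d)
    moreover have "trace [x, y] \<inter> trace (y # ys) = p ` (set [x, y] \<inter> set (y # ys))"
      using trace_Int[of "[x, y]" "y # ys"] graph_pathD[OF 1(2)] graph_pathD[OF P] xn
        ledges_subset_set[of "{x, y}" "y # ys"] by auto
    moreover have "set [x, y] \<inter> set (y # ys) = {y}" using xn by auto
    ultimately have "path_image d \<inter> path_image c = p ` {y}" using c(4) by metis
    then have "path_image d \<inter> path_image c = {p y}" by simp
    then have "arc (d +++ c)" by (intro arc_join) (use c d in auto)
    moreover have "path_image (d +++ c) = trace (x # y # ys)"
      using c d pxy by (subst path_image_join) (auto simp: trace_def)
    ultimately show ?thesis using c d ax by (intro exI[of _ "d +++ c"]) auto
  qed
qed (auto simp: graph_path_iff)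

lemma trace_subset: "graph_path V E a xs b \<Longrightarrow> trace xs \<subseteq> D"
  using graph_pathD[of V E a xs b] unfolding trace_def drawing_image_def by blast

lemma vertex_in_trace: "v \<in> set xs \<Longrightarrow> p v \<in> trace xs"
  by (auto simp: trace_def)

lemma vertex_outer: "v \<in> V \<Longrightarrow> p v \<in> frontier (outside D)"
  using outer by blast

lemma common_ends_disjoint_edges:
  assumes P: "graph_path V E a xs b" and Q: "graph_path V E a ys b"
    and "set xs \<inter> set ys = {a, b}" "length ys \<ge> 3"
  shows "ledges xs \<inter> ledges ys = {}"
proof (rule ccontr)
  assume "\<not> ?thesis"
  then obtain e where e: "e \<in> ledges xs" "e \<in> ledges ys" by blast
  then have "e \<subseteq> {a, b}" "card e = 2"
    using ledges_subset_set[of e] assms(3) card_edge graph_pathD[OF P] by blast+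
  then have "e = {a, b}"
    using card_seteq[of "{a, b}" e] card_insert_le_m1[of 2 "{b}" a] by simp
  then show False using ends_notin_ledges[of ys] graph_pathD[OF Q] assms(4) e by simp
qed

lemma single_common_disjoint_edges:
  assumes "ledges xs \<subseteq> E" "set xs \<inter> set ys \<subseteq> {a}"
  shows "ledges xs \<inter> ledges ys = {}"
proof (rule ccontr)
  assume "\<not> ?thesis"
  then obtain e where e: "e \<in> ledges xs" "e \<in> ledges ys" by blast
  then have "e \<subseteq> {a}" "card e = 2"
    using ledges_subset_set[of e] assms card_edge by blast+
  then show False using card_mono[of "{a}" e] by simp
qed

lemma inner_vertex:
  assumes "graph_path V E a xs b" "length xs \<ge> 3"
  shows "\<exists>x\<in>set xs. x \<noteq> a \<and> x \<noteq> b"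
proof -
  have "card {a, b} < card (set xs)"
    using graph_pathD[OF assms(1)] assms(2) card_insert_le_m1[of 2 "{b}" a] by (simp add: distinct_card)
  then have "\<not> set xs \<subseteq> {a, b}" using card_mono[of "{a, b}" "set xs"] by auto
  then show ?thesis by blast
qed

lemma inner_vertex_image:
  assumes "graph_path V E a xs b" "x \<in> set xs" "x \<noteq> a" "x \<noteq> b"
  shows "p x \<noteq> p a" "p x \<noteq> p b" "p x \<in> trace xs" "p x \<in> frontier (outside D)"
  using assms inj_onD[OF inj_p, of x a] inj_onD[OF inj_p, of x b] graph_pathD[OF assms(1)]
    vertex_in_trace vertex_outer by blast+

text \<open>In a theta graph two of whose paths have inner vertices, the third path is drawn inside the
  closed curve formed by these two.\<close>

lemma path_meets_inside:
  assumes ab: "a \<noteq> b"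
    and P: "graph_path V E a xs b" and Q: "graph_path V E a ys b" and R: "graph_path V E a zs b"
    and int: "set xs \<inter> set ys = {a, b}" "set xs \<inter> set zs = {a, b}" "set ys \<inter> set zs = {a, b}"
    and len: "length ys \<ge> 3" "length zs \<ge> 3"
  shows "trace xs \<inter> inside (trace ys \<union> trace zs) \<noteq> {}"
proof -
  obtain c1 where c1: "arc c1" "pathstart c1 = p a" "pathfinish c1 = p b" and t1: "path_image c1 = trace xs"
    using path_arc[OF P ab] by blast
  obtain c2 where c2: "arc c2" "pathstart c2 = p a" "pathfinish c2 = p b" and t2: "path_image c2 = trace ys"
    using path_arc[OF Q ab] by blast
  obtain c3 where c3: "arc c3" "pathstart c3 = p a" "pathfinish c3 = p b" and t3: "path_image c3 = trace zs"
    using path_arc[OF R ab] by blast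
  note p = graph_pathD[OF P] and q = graph_pathD[OF Q] and r = graph_pathD[OF R]
  have t12: "trace xs \<inter> trace ys = {p a, p b}"
    using trace_Int[OF p(4) q(4) p(6) q(6)] common_ends_disjoint_edges[OF P Q int(1) len(1)] int by simp
  have t13: "trace xs \<inter> trace zs = {p a, p b}"
    using trace_Int[OF p(4) r(4) p(6) r(6)] common_ends_disjoint_edges[OF P R int(2) len(2)] int by simp
  have t23: "trace ys \<inter> trace zs = {p a, p b}"
    using trace_Int[OF q(4) r(4) q(6) r(6)] common_ends_disjoint_edges[OF Q R int(3) len(2)] int by simp
  note sub = trace_subset[OF P] trace_subset[OF Q] trace_subset[OF R]
  obtain y where y: "y \<in> set ys" "y \<noteq> a" "y \<noteq> b" using inner_vertex[OF Q len(1)] by blast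
  obtain z where z: "z \<in> set zs" "z \<noteq> a" "z \<noteq> b" using inner_vertex[OF R len(2)] by blast
  note y = inner_vertex_image[OF Q y] and z = inner_vertex_image[OF R z]
  have "path_image c2 \<inter> inside (path_image c1 \<union> path_image c3) = {}"
    by (rule arc_avoids_inside[OF c2 c1 c3, of "p y" D])
      (use t12 t13 t23 sub y in \<open>auto simp: t1 t2 t3\<close>)
  moreover have "path_image c3 \<inter> inside (path_image c1 \<union> path_image c2) = {}"
    by (rule arc_avoids_inside[OF c3 c1 c2, of "p z" D])
      (use t12 t13 t23 sub z in \<open>auto simp: t1 t2 t3\<close>)
  ultimately show ?thesis
    using theta_arc_meets_inside[OF c1 c2 c3] t12 t13 t23 by (simp add: t1 t2 t3)
qed

text \<open>The drawing contains no subdivision of \<open>K\<^sub>2\<^sub>,\<^sub>3\<close>.\<close>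

lemma no_three_paths:
  assumes ab: "a \<noteq> b"
    and P: "graph_path V E a xs b" and Q: "graph_path V E a ys b" and R: "graph_path V E a zs b"
    and int: "set xs \<inter> set ys = {a, b}" "set xs \<inter> set zs = {a, b}" "set ys \<inter> set zs = {a, b}"
    and len: "length xs \<ge> 3" "length ys \<ge> 3" "length zs \<ge> 3"
  shows False
proof -
  obtain c1 where c1: "arc c1" "pathstart c1 = p a" "pathfinish c1 = p b" and t1: "path_image c1 = trace xs"
    using path_arc[OF P ab] by blast
  obtain c2 where c2: "arc c2" "pathstart c2 = p a" "pathfinish c2 = p b" and t2: "path_image c2 = trace ys"
    using path_arc[OF Q ab] by blast
  obtain c3 where c3: "arc c3" "pathstart c3 = p a" "pathfinish c3 = p b" and t3: "path_image c3 = trace zs"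
    using path_arc[OF R ab] by blast
  note p = graph_pathD[OF P] and q = graph_pathD[OF Q] and r = graph_pathD[OF R]
  have t12: "trace xs \<inter> trace ys = {p a, p b}"
    using trace_Int[OF p(4) q(4) p(6) q(6)] common_ends_disjoint_edges[OF P Q int(1) len(2)] int by simp
  have t13: "trace xs \<inter> trace zs = {p a, p b}"
    using trace_Int[OF p(4) r(4) p(6) r(6)] common_ends_disjoint_edges[OF P R int(2) len(3)] int by simp
  have t23: "trace ys \<inter> trace zs = {p a, p b}"
    using trace_Int[OF q(4) r(4) q(6) r(6)] common_ends_disjoint_edges[OF Q R int(3) len(3)] int by simp
  obtain x where x: "x \<in> set xs" "x \<noteq> a" "x \<noteq> b" using inner_vertex[OF P len(1)] by blast
  note x = inner_vertex_image[OF P x]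
  have "path_image c1 \<inter> inside (path_image c2 \<union> path_image c3) = {}"
    by (rule arc_avoids_inside[OF c1 c2 c3, of "p x" D])
      (use t12 t13 t23 trace_subset[OF Q] trace_subset[OF R] x in \<open>auto simp: t1 t2 t3\<close>)
  then show False using path_meets_inside[OF ab P Q R int len(2,3)] by (simp add: t1 t2 t3)
qed

text \<open>The drawing contains no subdivision of \<open>K\<^sub>4\<close> with branch vertices \<open>q i\<close> and paths \<open>P i j\<close>
  between them. The closed curve through all four branch vertices, in the order 0, 2, 1, 3, has the
  paths \<open>P 0 1\<close> and \<open>P 2 3\<close> as chords, and each of them runs inside it.\<close>

lemma no_K4_subdivision:
  fixes q :: "nat \<Rightarrow> 'a" and P :: "nat \<Rightarrow> nat \<Rightarrow> 'a list"
  assumes q: "inj_on q {..<4}"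
    and P: "\<And>i j. i < 4 \<Longrightarrow> j < 4 \<Longrightarrow> i \<noteq> j \<Longrightarrow> graph_path V E (q i) (P i j) (q j)"
    and sym: "\<And>i j. i < 4 \<Longrightarrow> j < 4 \<Longrightarrow> i \<noteq> j \<Longrightarrow> P j i = rev (P i j)"
    and int: "\<And>i j k l. i < 4 \<Longrightarrow> j < 4 \<Longrightarrow> k < 4 \<Longrightarrow> l < 4 \<Longrightarrow> i \<noteq> j \<Longrightarrow> k \<noteq> l \<Longrightarrow> {i, j} \<noteq> {k, l} \<Longrightarrow>
      set (P i j) \<inter> set (P k l) = q ` ({i, j} \<inter> {k, l})"
  shows False
proof -
  have ne: "q i \<noteq> q j" if "i < 4" "j < 4" "i \<noteq> j" for i j using inj_onD[OF q, of i j] that by auto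
  \<comment> \<open>The path from \<open>q i\<close> through \<open>q k\<close> to \<open>q j\<close>.\<close>
  define R where "R i k j = P i k @ tl (P k j)" for i k j
  have R: "graph_path V E (q i) (R i k j) (q j)" "set (R i k j) = set (P i k) \<union> set (P k j)"
    "ledges (R i k j) = ledges (P i k) \<union> ledges (P k j)" "length (R i k j) \<ge> 3"
    if "i < 4" "j < 4" "k < 4" "i \<noteq> j" "i \<noteq> k" "k \<noteq> j" for i j k
  proof -
    have "set (P i k) \<inter> set (P k j) = {q k}"
      using int[of i k k j] that by (auto simp: doubleton_eq_iff)
    then show R: "graph_path V E (q i) (R i k j) (q j)" "set (R i k j) = set (P i k) \<union> set (P k j)"
    "ledges (R i k j) = ledges (P i k) \<union> ledges (P k j)"
      unfolding R_def using graph_path_join[OF P[of i k] P[of k j]] that by simp_all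
    have "{q i, q j, q k} \<subseteq> set (R i k j)"
      unfolding R(2) using graph_pathD[OF P[of i k]] graph_pathD[OF P[of k j]] that by auto
    moreover have "card {q i, q j, q k} = 3" using ne that by simp
    ultimately show "length (R i k j) \<ge> 3"
      by (metis List.finite_set card_length card_mono le_trans)
  qed
  have trR: "trace (R i k j) = trace (P i k) \<union> trace (P k j)"
    if "i < 4" "j < 4" "k < 4" "i \<noteq> j" "i \<noteq> k" "k \<noteq> j" for i j k
    using R(2,3)[OF that] by (auto simp: trace_def)
  have trrev: "trace (P j i) = trace (P i j)" if "i < 4" "j < 4" "i \<noteq> j" for i j
    using sym[of i j] that by (simp add: trace_def ledges_rev)
  have setrev: "set (P j i) = set (P i j)" if "i < 4" "j < 4" "i \<noteq> j" for i j
    using sym[of i j] that by simp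
  have S: "set (P 0 1) \<inter> set (P 0 2) = {q 0}" "set (P 0 1) \<inter> set (P 2 1) = {q 1}"
    "set (P 0 1) \<inter> set (P 0 3) = {q 0}" "set (P 0 1) \<inter> set (P 3 1) = {q 1}"
    "set (P 0 2) \<inter> set (P 0 3) = {q 0}" "set (P 0 2) \<inter> set (P 3 1) = {}"
    "set (P 2 1) \<inter> set (P 0 3) = {}" "set (P 2 1) \<inter> set (P 3 1) = {q 1}"
    "set (P 2 3) \<inter> set (P 0 2) = {q 2}" "set (P 2 3) \<inter> set (P 2 1) = {q 2}"
    "set (P 2 3) \<inter> set (P 0 3) = {q 3}" "set (P 2 3) \<inter> set (P 3 1) = {q 3}"
    "set (P 2 3) \<inter> set (P 0 1) = {}" "set (P 0 2) \<inter> set (P 2 1) = {q 2}"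
    "set (P 0 3) \<inter> set (P 3 1) = {q 3}" "set (P 0 3) \<inter> set (P 2 1) = {}"
    using int[of 0 2 2 1] int[of 0 3 3 1] int[of 0 3 2 1] int[of 0 1 0 2] int[of 0 1 2 1] int[of 0 1 0 3] int[of 0 1 3 1] int[of 0 2 0 3] int[of 0 2 3 1]
      int[of 2 1 0 3] int[of 2 1 3 1] int[of 2 3 0 2] int[of 2 3 2 1] int[of 2 3 0 3] int[of 2 3 3 1]
      int[of 2 3 0 1] by (simp_all add: doubleton_eq_iff)
  have rev: "set (P 2 0) = set (P 0 2)" "set (P 1 3) = set (P 3 1)"
    using setrev[of 0 2] setrev[of 3 1] by simp_all
  have I': "set (P 2 3) \<inter> set (R 2 0 3) = {q 2, q 3}" "set (P 2 3) \<inter> set (R 2 1 3) = {q 2, q 3}"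
    "set (R 2 0 3) \<inter> set (R 2 1 3) = {q 2, q 3}"
    using R(2)[of 2 3 0] R(2)[of 2 3 1] S rev
    by (simp_all add: Int_Un_distrib Int_Un_distrib2 insert_commute)
  have in2: "trace (P 2 3) \<inter> inside (trace (R 2 0 3) \<union> trace (R 2 1 3)) \<noteq> {}"
    by (rule path_meets_inside[of "q 2" "q 3"]) (use ne[of 2 3] P[of 2 3] R(1,4)[of 2 3] I' in simp_all)
  moreover have "trace (R 2 0 3) \<union> trace (R 2 1 3) = trace (R 0 2 1) \<union> trace (R 0 3 1)"
    using trrev[of 0 2] trrev[of 3 1] by (auto simp: trR)
  ultimately have ein: "trace (P 2 3) \<inter> inside (trace (R 0 2 1) \<union> trace (R 0 3 1)) \<noteq> {}" by simp
  have R2: "graph_path V E (q 0) (R 0 2 1) (q 1)" "length (R 0 2 1) \<ge> 3"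
    and R3: "graph_path V E (q 0) (R 0 3 1) (q 1)" "length (R 0 3 1) \<ge> 3"
    and P01: "graph_path V E (q 0) (P 0 1) (q 1)" and P23: "graph_path V E (q 2) (P 2 3) (q 3)"
    using R[of 0 1 2] R[of 0 1 3] P[of 0 1] P[of 2 3] by auto
  have ne': "q 0 \<noteq> q 1" "q 2 \<noteq> q 3" using ne[of 0 1] ne[of 2 3] by auto
  obtain c1 where c1: "arc c1" "pathstart c1 = p (q 0)" "pathfinish c1 = p (q 1)"
    and t1: "path_image c1 = trace (R 0 2 1)" using path_arc[OF R2(1) ne'(1)] by blast
  obtain c2 where c2: "arc c2" "pathstart c2 = p (q 0)" "pathfinish c2 = p (q 1)"
    and t2: "path_image c2 = trace (R 0 3 1)" using path_arc[OF R3(1) ne'(1)] by blast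
  obtain c where c: "arc c" "pathstart c = p (q 0)" "pathfinish c = p (q 1)"
    and t: "path_image c = trace (P 0 1)" using path_arc[OF P01(1) ne'(1)] by blast
  obtain e where e: "arc e" "pathstart e = p (q 2)" "pathfinish e = p (q 3)"
    and te: "path_image e = trace (P 2 3)" using path_arc[OF P23(1) ne'(2)] by blast
  have I: "set (R 0 2 1) \<inter> set (R 0 3 1) = {q 0, q 1}" "set (P 0 1) \<inter> set (R 0 2 1) = {q 0, q 1}"
    "set (P 0 1) \<inter> set (R 0 3 1) = {q 0, q 1}" "set (P 2 3) \<inter> set (R 0 2 1) = {q 2}"
    "set (P 2 3) \<inter> set (R 0 3 1) = {q 3}" "set (P 2 3) \<inter> set (P 0 1) = {}"
    using R(2)[of 0 1 2] R(2)[of 0 1 3] S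
    by (simp_all add: Int_Un_distrib Int_Un_distrib2 insert_commute)
  note d = graph_pathD(4,6)[OF R2(1)] graph_pathD(4,6)[OF R3(1)] graph_pathD(4,6)[OF P01] graph_pathD(4,6)[OF P23]
  have T: "trace (R 0 2 1) \<inter> trace (R 0 3 1) = {p (q 0), p (q 1)}"
    using trace_Int[OF d(1,3,2,4) common_ends_disjoint_edges[OF R2(1) R3(1) I(1) R3(2)]] I by simp
  have T2: "trace (P 0 1) \<inter> trace (R 0 2 1) = {p (q 0), p (q 1)}"
    using trace_Int[OF d(5,1,6,2) common_ends_disjoint_edges[OF P01 R2(1) I(2) R2(2)]] I by simp
  have T3: "trace (P 0 1) \<inter> trace (R 0 3 1) = {p (q 0), p (q 1)}"
    using trace_Int[OF d(5,3,6,4) common_ends_disjoint_edges[OF P01 R3(1) I(3) R3(2)]] I by simp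
  have T4: "trace (P 2 3) \<inter> trace (R 0 2 1) = {p (q 2)}" "trace (P 2 3) \<inter> trace (R 0 3 1) = {p (q 3)}"
    "trace (P 2 3) \<inter> trace (P 0 1) = {}"
    using trace_Int[OF d(7,1,8,2) single_common_disjoint_edges[OF d(8), of _ "q 2"]]
      trace_Int[OF d(7,3,8,4) single_common_disjoint_edges[OF d(8), of _ "q 3"]]
      trace_Int[OF d(7,5,8,6) single_common_disjoint_edges[OF d(8)]] I by auto
  have m: "q 2 \<in> set (R 0 2 1)" "q 3 \<in> set (R 0 3 1)"
    using I by blast+
  have n: "q 2 \<noteq> q 0" "q 2 \<noteq> q 1" "q 3 \<noteq> q 0" "q 3 \<noteq> q 1"
    using ne[of 2 0] ne[of 2 1] ne[of 3 0] ne[of 3 1] by auto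
  note v2 = inner_vertex_image[OF R2(1) m(1) n(1,2)] and v3 = inner_vertex_image[OF R3(1) m(2) n(3,4)]
  show False
    by (rule no_crossing_chords[OF c1 c2 c, of "p (q 2)" D "p (q 3)" e, unfolded t1 t2 t te])
      (use v2 v3 ein e T T2 T3 T4 trace_subset[OF R2(1)] trace_subset[OF R3(1)] trace_subset[OF P01]
        in \<open>simp_all add: Int_Un_distrib Int_commute\<close>)
qed

end

section \<open>Connected sets and minors\<close>

text \<open>Two vertex sets touch if an edge joins them.\<close>

definition touch :: "'a set set \<Rightarrow> 'a set \<Rightarrow> 'a set \<Rightarrow> bool" where
  "touch E X Y \<longleftrightarrow> (\<exists>x\<in>X. \<exists>y\<in>Y. {x, y} \<in> E)"

text \<open>Connectedness of a nonempty vertex set in the graph with edge set \<open>E\<close>, stated by cuts: an edge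
  leaves every proper nonempty subset. \<open>conn_graph_path\<close> provides the paths.\<close>

definition conn :: "'a set set \<Rightarrow> 'a set \<Rightarrow> bool" where
  "conn E X \<longleftrightarrow> X \<noteq> {} \<and> (\<forall>Y. Y \<subset> X \<and> Y \<noteq> {} \<longrightarrow> touch E Y (X - Y))"

lemma touch_sym: "touch E X Y \<longleftrightarrow> touch E Y X"
proof -
  have "touch E Y X" if "touch E X Y" for X Y
    using that unfolding touch_def by (metis insert_commute)
  then show ?thesis by blast
qed

lemma touch_mono: "touch E X Y \<Longrightarrow> X \<subseteq> X' \<Longrightarrow> Y \<subseteq> Y' \<Longrightarrow> touch E X' Y'"
  unfolding touch_def by blast

lemma touchI: "{x, y} \<in> E \<Longrightarrow> x \<in> X \<Longrightarrow> y \<in> Y \<Longrightarrow> touch E X Y"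
  unfolding touch_def by blast

lemma conn_nonempty: "conn E X \<Longrightarrow> X \<noteq> {}"
  by (simp add: conn_def)

lemma conn_cut: "conn E X \<Longrightarrow> Y \<subset> X \<Longrightarrow> Y \<noteq> {} \<Longrightarrow> touch E Y (X - Y)"
  by (simp add: conn_def)

lemma conn_singleton [simp]: "conn E {x}"
proof -
  have "Y = {}" if "Y \<subset> {x}" for Y using that by (auto simp: psubset_eq subset_singleton_iff)
  then show ?thesis unfolding conn_def by auto
qed

lemma conn_attach:
  assumes "conn E R" "\<And>x. x \<in> L \<Longrightarrow> touch E {x} R"
  shows "conn E (R \<union> L)"
  unfolding conn_def
proof (intro conjI allI impI)
  show "R \<union> L \<noteq> {}" using assms(1) by (simp add: conn_nonempty)
next
  fix Y assume Y: "Y \<subset> R \<union> L \<and> Y \<noteq> {}"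
  consider "R \<inter> Y \<noteq> {}" "R \<inter> Y \<subset> R" | "R \<subseteq> Y" | "R \<inter> Y = {}" by (auto simp: psubset_eq)
  then show "touch E Y (R \<union> L - Y)"
  proof cases
    case 1
    show ?thesis by (rule touch_mono[OF conn_cut[OF assms(1) 1(2,1)]]) auto
  next
    case 2
    then obtain x where "x \<in> L" "x \<notin> Y" using Y by auto
    then have "touch E R {x}" using assms(2)[of x] touch_sym by metis
    then show ?thesis by (rule touch_mono) (use 2 \<open>x \<in> L\<close> \<open>x \<notin> Y\<close> in auto)
  next
    case 3
    then obtain x where "x \<in> L" "x \<in> Y" using Y by auto
    show ?thesis by (rule touch_mono[OF assms(2)[OF \<open>x \<in> L\<close>]]) (use 3 \<open>x \<in> Y\<close> in auto)
  qed
qed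

lemma conn_insert: "conn E X \<Longrightarrow> touch E {x} X \<Longrightarrow> conn E (insert x X)"
  using conn_attach[of E X "{x}"] by simp

lemma conn_set_walk: "xs \<noteq> [] \<Longrightarrow> ledges xs \<subseteq> E \<Longrightarrow> conn E (set xs)"
proof (induction xs rule: ledges.induct)
  case (1 x y ys)
  then have "conn E (set (y # ys))" "touch E {x} (set (y # ys))" by (auto simp: touch_def)
  then show ?case using conn_insert[of E "set (y # ys)" x] by simp
qed auto

text \<open>Connectedness is preserved if connected sets that touch along the edges are substituted for
  the vertices. No disjointness is needed.\<close>

lemma conn_UN:
  assumes X: "conn E' X" and F: "\<And>x. x \<in> X \<Longrightarrow> conn E (F x)"
    and e: "\<And>x y. x \<in> X \<Longrightarrow> y \<in> X \<Longrightarrow> x \<noteq> y \<Longrightarrow> {x, y} \<in> E' \<Longrightarrow> touch E (F x) (F y)"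
  shows "conn E (\<Union>x\<in>X. F x)"
  unfolding conn_def
proof (intro conjI allI impI)
  obtain x where "x \<in> X" using conn_nonempty[OF X] by auto
  then show "(\<Union>x\<in>X. F x) \<noteq> {}" using conn_nonempty[OF F[of x]] by auto
next
  fix Y assume Y: "Y \<subset> (\<Union>x\<in>X. F x) \<and> Y \<noteq> {}"
  show "touch E Y ((\<Union>x\<in>X. F x) - Y)"
  proof (cases "\<exists>x\<in>X. F x \<inter> Y \<noteq> {} \<and> \<not> F x \<subseteq> Y")
    case True
    then obtain x where x: "x \<in> X" "F x \<inter> Y \<noteq> {}" "\<not> F x \<subseteq> Y" by auto
    then have "F x \<inter> Y \<subset> F x" by auto
    from conn_cut[OF F[OF x(1)] this x(2)] show ?thesis
      by (rule touch_mono) (use x in auto)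
  next
    case False
    define W where "W = {x \<in> X. F x \<subseteq> Y}"
    have all: "F x \<subseteq> Y" if "x \<in> X" "F x \<inter> Y \<noteq> {}" for x using False that by auto
    obtain y where "y \<in> Y" using Y by auto
    then obtain x where "x \<in> X" "y \<in> F x" using Y by auto
    then have "x \<in> W" using all[of x] \<open>y \<in> Y\<close> by (auto simp: W_def)
    then have W0: "W \<noteq> {}" by auto
    have "W \<noteq> X"
    proof
      assume "W = X"
      then have "(\<Union>x\<in>X. F x) \<subseteq> Y" by (auto simp: W_def)
      then show False using Y by (meson psubset_imp_subset subset_not_subset_eq)
    qed
    then have W: "W \<subset> X" "W \<noteq> {}" using W0 by (auto simp: W_def)
    from conn_cut[OF X W] obtain x y where xy: "x \<in> W" "y \<in> X" "y \<notin> W" "{x, y} \<in> E'"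
      unfolding touch_def by blast
    have "x \<in> X" "x \<noteq> y" using xy by (auto simp: W_def)
    then have "touch E (F x) (F y)" by (rule e[OF _ xy(2) _ xy(4)])
    moreover have "F x \<subseteq> Y" using xy(1) by (simp add: W_def)
    moreover have "F y \<inter> Y = {}" using all[OF xy(2)] xy(2,3) by (auto simp: W_def)
    ultimately show ?thesis using xy(2) touch_mono[of E "F x" "F y" Y "(\<Union>x\<in>X. F x) - Y"] by auto
  qed
qed

lemma graph_path_mono: "graph_path X E a xs b \<Longrightarrow> X \<subseteq> V \<Longrightarrow> graph_path V E a xs b"
  by (auto simp: graph_path_iff)

lemma graph_path_append:
  assumes "graph_path V E a xs b" "graph_path V E c ys d" "{b, c} \<in> E" "set xs \<inter> set ys = {}"
  shows "graph_path V E a (xs @ ys) d"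
  using assms by (auto simp: graph_path_iff ledges_append)

lemma graph_path_split:
  assumes "graph_path V E a (us @ c # vs) b"
  shows "graph_path V E a (us @ [c]) c" "graph_path V E c (c # vs) b"
proof -
  have "ledges (us @ c # vs) = ledges (us @ [c]) \<union> ledges (c # vs)"
    using ledges_append_tl[of "us @ [c]" "c # vs"] by simp
  then show "graph_path V E a (us @ [c]) c" "graph_path V E c (c # vs) b"
    using assms by (auto simp: graph_path_iff hd_append)
qed

text \<open>The vertex set \<open>X\<close> in place of \<open>V\<close> keeps the path inside \<open>X\<close>.\<close>

lemma conn_graph_path:
  assumes X: "conn E X" and ab: "a \<in> X" "b \<in> X"
  shows "\<exists>xs. graph_path X E a xs b"
proof -
  define Y where "Y = {z \<in> X. \<exists>xs. graph_path X E a xs z}"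
  have "graph_path X E a [a] a" using ab by (simp add: graph_path_iff)
  then have aY: "a \<in> Y" using ab by (auto simp: Y_def)
  have "Y = X"
  proof (rule ccontr)
    assume "Y \<noteq> X"
    then have "Y \<subset> X" by (auto simp: Y_def)
    from conn_cut[OF X this] aY obtain y z where yz: "y \<in> Y" "z \<in> X" "z \<notin> Y" "{y, z} \<in> E"
      unfolding touch_def by blast
    from yz(1) obtain xs where xs: "graph_path X E a xs y" by (auto simp: Y_def)
    have "z \<notin> set xs"
    proof
      assume "z \<in> set xs"
      then obtain us vs where "xs = us @ z # vs" by (auto simp: in_set_conv_decomp)
      then have "graph_path X E a (us @ [z]) z" using graph_path_split xs by metis
      then show False using yz by (auto simp: Y_def)
    qed
    moreover have "graph_path X E z [z] z" using yz by (simp add: graph_path_iff)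
    ultimately have "graph_path X E a (xs @ [z]) z"
      using graph_path_append[OF xs _ yz(4)] by simp
    then show False using yz by (auto simp: Y_def)
  qed
  then show ?thesis using ab by (auto simp: Y_def)
qed

text \<open>Any three vertices of a connected set are the feet of a tripod: follow a path from \<open>a3\<close> until it
  first meets a path between \<open>a1\<close> and \<open>a2\<close>.\<close>

lemma conn_tripod:
  assumes X: "conn E X" and a: "a1 \<in> X" "a2 \<in> X" "a3 \<in> X"
  obtains c P1 P2 P3 where "graph_path X E c P1 a1" "graph_path X E c P2 a2" "graph_path X E c P3 a3"
    "set P1 \<inter> set P2 = {c}" "set P1 \<inter> set P3 = {c}" "set P2 \<inter> set P3 = {c}"
proof -
  obtain Q where Q: "graph_path X E a1 Q a2" using conn_graph_path[OF X a(1,2)] by blast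
  obtain R where R: "graph_path X E a3 R a1" using conn_graph_path[OF X a(3,1)] by blast
  have "\<exists>c\<in>set R. c \<in> set Q" using graph_pathD[OF Q] graph_pathD[OF R] by blast
  then obtain us c vs where Rs: "R = us @ c # vs" "c \<in> set Q" "\<forall>u\<in>set us. u \<notin> set Q"
    using split_list_first_prop[of R "\<lambda>c. c \<in> set Q"] by blast
  obtain qs rs where Qs: "Q = qs @ c # rs" using Rs(2) by (auto simp: in_set_conv_decomp)
  have "graph_path X E c (rev (qs @ [c])) a1" "graph_path X E c (c # rs) a2"
    using graph_path_split[of X E a1 qs c rs a2] graph_path_rev[of X E a1 "qs @ [c]" c] Q
    by (auto simp: Qs simp del: rev_append)
  moreover have "graph_path X E c (rev (us @ [c])) a3"
    using graph_path_split(1)[of X E a3 us c vs a1] graph_path_rev[of X E a3 "us @ [c]" c] R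
    by (auto simp: Rs simp del: rev_append)
  moreover have "distinct Q" using graph_pathD[OF Q] by simp
  then have "set (rev (qs @ [c])) \<inter> set (c # rs) = {c}" by (auto simp: Qs)
  moreover have "set (rev (qs @ [c])) \<inter> set (rev (us @ [c])) = {c}"
    "set (c # rs) \<inter> set (rev (us @ [c])) = {c}" using Rs(3) by (auto simp: Qs)
  ultimately show thesis by (rule that)
qed

text \<open>The graph \<open>(V, E)\<close> has the graph on the vertices \<open>0, \<dots>, n - 1\<close> with the edges \<open>R\<close> as a minor.
  The branch sets \<open>M i\<close> are disjoint and connected, and they touch along \<open>R\<close>.\<close>

definition has_minor :: "'a set \<Rightarrow> 'a set set \<Rightarrow> nat \<Rightarrow> (nat \<times> nat) set \<Rightarrow> bool" where
  "has_minor V E n R \<longleftrightarrow> (\<exists>M. (\<forall>i<n. M i \<subseteq> V \<and> conn E (M i)) \<and>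
     (\<forall>i<n. \<forall>j<n. i \<noteq> j \<longrightarrow> M i \<inter> M j = {}) \<and>
     (\<forall>(i, j)\<in>R. touch E (M i) (M j)))"

text \<open>The edges of \<open>K\<^sub>2\<^sub>,\<^sub>3\<close>, with colour classes \<open>{0, 1}\<close> and \<open>{2, 3, 4}\<close>.\<close>

definition K23 :: "(nat \<times> nat) set" where "K23 = {0, 1} \<times> {2, 3, 4}"

text \<open>The edges of \<open>K\<^sub>4\<close>, each listed once.\<close>

definition K4 :: "(nat \<times> nat) set" where "K4 = {(i, j). i < j \<and> j < 4}"

text \<open>The combinatorial side of outerplanarity: neither \<open>K\<^sub>2\<^sub>,\<^sub>3\<close> nor \<open>K\<^sub>4\<close> is a minor.\<close>

definition minor_free :: "'a set \<Rightarrow> 'a set set \<Rightarrow> bool" where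
  "minor_free V E \<longleftrightarrow> \<not> has_minor V E 5 K23 \<and> \<not> has_minor V E 4 K4"

lemma has_minor_lift:
  assumes m: "has_minor V' E' n R" and R: "R \<subseteq> {(i, j). i < n \<and> j < n \<and> i \<noteq> j}"
    and F: "\<And>x. x \<in> V' \<Longrightarrow> F x \<subseteq> V \<and> conn E (F x)"
    and disj: "\<And>x y. x \<in> V' \<Longrightarrow> y \<in> V' \<Longrightarrow> x \<noteq> y \<Longrightarrow> F x \<inter> F y = {}"
    and e: "\<And>x y. x \<in> V' \<Longrightarrow> y \<in> V' \<Longrightarrow> x \<noteq> y \<Longrightarrow> {x, y} \<in> E' \<Longrightarrow> touch E (F x) (F y)"
  shows "has_minor V E n R"
proof -
  from m obtain M where M0: "\<forall>i<n. M i \<subseteq> V' \<and> conn E' (M i)"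
    "\<forall>i<n. \<forall>j<n. i \<noteq> j \<longrightarrow> M i \<inter> M j = {}" "\<forall>(i, j)\<in>R. touch E' (M i) (M j)"
    unfolding has_minor_def by (elim exE conjE)
  have M: "M i \<subseteq> V' \<and> conn E' (M i)" if "i < n" for i
    using M0(1) that by simp
  have Md: "M i \<inter> M j = {}" if "i < n" "j < n" "i \<noteq> j" for i j
    using M0(2) that by simp
  have Mt: "touch E' (M i) (M j)" if "(i, j) \<in> R" for i j
    using M0(3) that by auto
  define N where "N i = (\<Union>x\<in>M i. F x)" for i
  have "N i \<subseteq> V \<and> conn E (N i)" if "i < n" for i
  proof
    have sub: "M i \<subseteq> V'" and con: "conn E' (M i)" using M[OF that] by auto
    have in': "x \<in> V'" if "x \<in> M i" for x using sub that by (rule subsetD)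
    show "N i \<subseteq> V"
    proof
      fix y assume "y \<in> N i"
      then obtain x where "x \<in> M i" "y \<in> F x" by (auto simp: N_def)
      then show "y \<in> V" using F[OF in'] by (meson subsetD)
    qed
    show "conn E (N i)" unfolding N_def
    proof (rule conn_UN[OF con])
      fix x assume "x \<in> M i"
      then show "conn E (F x)" using F[OF in'] by simp
    next
      fix x y assume "x \<in> M i" "y \<in> M i" "x \<noteq> y" "{x, y} \<in> E'"
      then show "touch E (F x) (F y)" using e[OF in' in'] by simp
    qed
  qed
  moreover have "N i \<inter> N j = {}" if ij: "i < n" "j < n" "i \<noteq> j" for i j
  proof (rule ccontr)
    assume "N i \<inter> N j \<noteq> {}"
    then obtain x y where xy: "x \<in> M i" "y \<in> M j" "F x \<inter> F y \<noteq> {}" by (auto simp: N_def)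
    have "x \<noteq> y" "x \<in> V'" "y \<in> V'"
      using xy(1,2) subsetD[of "M i" V' x] subsetD[of "M j" V' y] M[OF ij(1)] M[OF ij(2)] Md[OF ij]
      by auto
    then show False using disj[of x y] xy by simp
  qed
  moreover have "touch E (N i) (N j)" if ij: "(i, j) \<in> R" for i j
  proof -
    obtain x y where xy: "x \<in> M i" "y \<in> M j" "{x, y} \<in> E'" using Mt[OF ij] by (auto simp: touch_def)
    have n: "i < n" "j < n" "i \<noteq> j" using R ij by auto
    have "x \<noteq> y" "x \<in> V'" "y \<in> V'"
      using xy(1,2) subsetD[of "M i" V' x] subsetD[of "M j" V' y] M[OF n(1)] M[OF n(2)] Md[OF n]
      by auto
    then have "touch E (F x) (F y)" using e xy(3) by simp
    then show ?thesis by (rule touch_mono) (use xy in \<open>auto simp: N_def\<close>)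
  qed
  ultimately show ?thesis unfolding has_minor_def by (intro exI[of _ N]) auto
qed

text \<open>Deletions and contractions preserve the class: \<open>F x\<close> is the set of vertices of the large graph
  that are contracted to the vertex \<open>x\<close> of the small one.\<close>

lemma minor_free_contract:
  assumes m: "minor_free V E"
    and F: "\<And>x. x \<in> V' \<Longrightarrow> F x \<subseteq> V \<and> conn E (F x)"
    and disj: "\<And>x y. x \<in> V' \<Longrightarrow> y \<in> V' \<Longrightarrow> x \<noteq> y \<Longrightarrow> F x \<inter> F y = {}"
    and e: "\<And>x y. x \<in> V' \<Longrightarrow> y \<in> V' \<Longrightarrow> x \<noteq> y \<Longrightarrow> {x, y} \<in> E' \<Longrightarrow> touch E (F x) (F y)"
  shows "minor_free V' E'"
proof -
  have "K23 \<subseteq> {(i, j). i < 5 \<and> j < 5 \<and> i \<noteq> j}" "K4 \<subseteq> {(i, j). i < 4 \<and> j < 4 \<and> i \<noteq> j}"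
    by (auto simp: K23_def K4_def)
  note R = this
  have "has_minor V E 5 K23" if "has_minor V' E' 5 K23" by (rule has_minor_lift[OF that R(1) F disj e])
  moreover have "has_minor V E 4 K4" if "has_minor V' E' 4 K4" by (rule has_minor_lift[OF that R(2) F disj e])
  ultimately show ?thesis using m by (auto simp: minor_free_def)
qed

lemma K23_minorI:
  assumes "A \<subseteq> V" "B \<subseteq> V" "C1 \<subseteq> V" "C2 \<subseteq> V" "C3 \<subseteq> V"
    and "conn E A" "conn E B" "conn E C1" "conn E C2" "conn E C3"
    and "A \<inter> B = {}" "A \<inter> C1 = {}" "A \<inter> C2 = {}" "A \<inter> C3 = {}" "B \<inter> C1 = {}" "B \<inter> C2 = {}"
      "B \<inter> C3 = {}" "C1 \<inter> C2 = {}" "C1 \<inter> C3 = {}" "C2 \<inter> C3 = {}"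
    and "touch E A C1" "touch E A C2" "touch E A C3" "touch E B C1" "touch E B C2" "touch E B C3"
  shows "has_minor V E 5 K23"
  unfolding has_minor_def
proof (intro exI conjI)
  let ?M = "\<lambda>i. [A, B, C1, C2, C3] ! i"
  have lt: "i < 5 \<longleftrightarrow> i = 0 \<or> i = 1 \<or> i = 2 \<or> i = 3 \<or> i = 4" for i :: nat by auto
  show "\<forall>i<5. ?M i \<subseteq> V \<and> conn E (?M i)" using assms by (auto simp: lt)
  show "\<forall>i<5. \<forall>j<5. i \<noteq> j \<longrightarrow> ?M i \<inter> ?M j = {}" using assms by (auto simp: lt Int_commute)
  show "\<forall>(i, j)\<in>K23. touch E (?M i) (?M j)" using assms by (simp add: K23_def)
qed

lemma K4_minorI:
  assumes "A \<subseteq> V" "B \<subseteq> V" "C \<subseteq> V" "D \<subseteq> V"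
    and "conn E A" "conn E B" "conn E C" "conn E D"
    and "A \<inter> B = {}" "A \<inter> C = {}" "A \<inter> D = {}" "B \<inter> C = {}" "B \<inter> D = {}" "C \<inter> D = {}"
    and "touch E A B" "touch E A C" "touch E A D" "touch E B C" "touch E B D" "touch E C D"
  shows "has_minor V E 4 K4"
  unfolding has_minor_def
proof (intro exI conjI)
  let ?M = "\<lambda>i. [A, B, C, D] ! i"
  have lt: "i < 4 \<longleftrightarrow> i = 0 \<or> i = 1 \<or> i = 2 \<or> i = 3" for i :: nat by auto
  show "\<forall>i<4. ?M i \<subseteq> V \<and> conn E (?M i)" using assms by (auto simp: lt)
  show "\<forall>i<4. \<forall>j<4. i \<noteq> j \<longrightarrow> ?M i \<inter> ?M j = {}" using assms by (auto simp: lt Int_commute)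
  have "K4 = {(0,1), (0,2), (0,3), (1,2), (1,3), (2,3)}" by (auto simp: K4_def)
  show "\<forall>(i, j)\<in>K4. touch E (?M i) (?M j)" unfolding \<open>K4 = _\<close> using assms by simp
qed

section \<open>Outerplanar graphs have neither minor\<close>

lemma conn_tripod_family:
  assumes X: "conn E X" and J: "card J = 3" and a: "\<And>j. j \<in> J \<Longrightarrow> a j \<in> X"
  shows "\<exists>c L. (\<forall>j\<in>J. graph_path X E c (L j) (a j)) \<and>
    (\<forall>i\<in>J. \<forall>j\<in>J. i \<noteq> j \<longrightarrow> set (L i) \<inter> set (L j) = {c})"
proof -
  obtain i j k where J': "J = {i, j, k}" "i \<noteq> j" "j \<noteq> k" "i \<noteq> k"
    using J unfolding card_3_iff by blast
  obtain c P1 P2 P3 where P: "graph_path X E c P1 (a i)" "graph_path X E c P2 (a j)" "graph_path X E c P3 (a k)"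
    "set P1 \<inter> set P2 = {c}" "set P1 \<inter> set P3 = {c}" "set P2 \<inter> set P3 = {c}"
  proof (rule conn_tripod[OF X])
    show "a i \<in> X" "a j \<in> X" "a k \<in> X" using a J' by auto
  qed
  define L where "L = (\<lambda>x. if x = i then P1 else if x = j then P2 else P3)"
  have "graph_path X E c (L x) (a x)" if "x \<in> J" for x
    using that J' P by (auto simp: L_def)
  moreover have "set (L x) \<inter> set (L y) = {c}" if "x \<in> J" "y \<in> J" "x \<noteq> y" for x y
    using that J' P by (auto simp: L_def Int_commute)
  ultimately show ?thesis by (intro exI[of _ c] exI[of _ L]) simp
qed

context outer_drawing
begin

text \<open>In \<open>K\<^sub>2\<^sub>,\<^sub>3\<close> and \<open>K\<^sub>4\<close> all degrees are at most 3, so that a minor yields a subdivision: tripods in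
  the branch sets provide the branch vertices.\<close>

lemma no_K23_minor: "\<not> has_minor V E 5 K23"
proof
  assume "has_minor V E 5 K23"
  then obtain M where M0: "\<forall>i<5. M i \<subseteq> V \<and> conn E (M i)"
    "\<forall>i<5. \<forall>j<5. i \<noteq> j \<longrightarrow> M i \<inter> M j = {}" "\<forall>(i, j)\<in>K23. touch E (M i) (M j)"
    unfolding has_minor_def by (elim exE conjE)
  define J :: "nat set" where "J = {2, 3, 4}"
  have J: "card J = 3" "finite J" by (simp_all add: J_def)
  have M: "M i \<subseteq> V" "conn E (M i)" if "i < 5" for i using M0(1) that by auto
  have Md: "M i \<inter> M j = {}" if "i < 5" "j < 5" "i \<noteq> j" for i j using M0(2) that by simp
  have Mt: "touch E (M 0) (M j)" "touch E (M 1) (M j)" if "j \<in> J" for j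
    using M0(3) that by (auto simp: K23_def J_def)
  have J5: "j < 5" "j \<noteq> 0" "j \<noteq> 1" if "j \<in> J" for j using that by (auto simp: J_def)
  \<comment> \<open>For each of the three sets of the larger colour class, an edge to either of the other two sets.\<close>
  have "\<forall>j\<in>J. \<exists>a x. a \<in> M 0 \<and> x \<in> M j \<and> {a, x} \<in> E" using Mt(1) unfolding touch_def by blast
  then obtain a x where ax: "\<And>j. j \<in> J \<Longrightarrow> a j \<in> M 0 \<and> x j \<in> M j \<and> {a j, x j} \<in> E" by metis
  have "\<forall>j\<in>J. \<exists>b y. b \<in> M 1 \<and> y \<in> M j \<and> {b, y} \<in> E" using Mt(2) unfolding touch_def by blast
  then obtain b y where by': "\<And>j. j \<in> J \<Longrightarrow> b j \<in> M 1 \<and> y j \<in> M j \<and> {b j, y j} \<in> E" by metis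
  have "\<forall>j\<in>J. \<exists>xs. graph_path (M j) E (x j) xs (y j)"
    using conn_graph_path[OF M(2)] ax by' J5 by simp
  then obtain Q where Q: "\<And>j. j \<in> J \<Longrightarrow> graph_path (M j) E (x j) (Q j) (y j)" by metis
  have "a j \<in> M 0" if "j \<in> J" for j using ax[OF that] by simp
  from conn_tripod_family[OF M(2) J(1), of 0 a, OF _ this]
  obtain c L where L0: "\<forall>j\<in>J. graph_path (M 0) E c (L j) (a j)"
    "\<forall>i\<in>J. \<forall>j\<in>J. i \<noteq> j \<longrightarrow> set (L i) \<inter> set (L j) = {c}"
    by auto
  have L: "graph_path (M 0) E c (L j) (a j)" if "j \<in> J" for j using L0(1) that by simp
  have L2: "set (L i) \<inter> set (L j) = {c}" if "i \<in> J" "j \<in> J" "i \<noteq> j" for i j using L0(2) that by simp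
  have "b j \<in> M 1" if "j \<in> J" for j using by'[OF that] by simp
  from conn_tripod_family[OF M(2) J(1), of 1 b, OF _ this]
  obtain d N where N0: "\<forall>j\<in>J. graph_path (M 1) E d (N j) (b j)"
    "\<forall>i\<in>J. \<forall>j\<in>J. i \<noteq> j \<longrightarrow> set (N i) \<inter> set (N j) = {d}"
    by auto
  have N: "graph_path (M 1) E d (N j) (b j)" if "j \<in> J" for j using N0(1) that by simp
  have N2: "set (N i) \<inter> set (N j) = {d}" if "i \<in> J" "j \<in> J" "i \<noteq> j" for i j using N0(2) that by simp
  define T where "T j = L j @ Q j @ rev (N j)" for j
  have T: "graph_path V E c (T j) d \<and> length (T j) \<ge> 3" if j: "j \<in> J" for j
  proof -
    note l = graph_pathD[OF L[OF j]] and q = graph_pathD[OF Q[OF j]] and n = graph_pathD[OF N[OF j]]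
    have sub: "M 0 \<subseteq> V" "M 1 \<subseteq> V" "M j \<subseteq> V" using M(1) J5(1)[OF j] by simp_all
    have P1: "graph_path V E c (L j) (a j)" using graph_path_mono[OF L[OF j] sub(1)] .
    have P2: "graph_path V E (x j) (Q j) (y j)" using graph_path_mono[OF Q[OF j] sub(3)] .
    have P3: "graph_path V E (b j) (rev (N j)) d"
      using graph_path_rev[OF graph_path_mono[OF N[OF j] sub(2)]] .
    have d: "M 0 \<inter> M j = {}" "M 1 \<inter> M j = {}" "M 0 \<inter> M 1 = {}"
      using Md[of 0 j] Md[of 1 j] Md[of 0 1] J5[OF j] by simp_all
    have e: "{y j, b j} \<in> E" "{a j, x j} \<in> E" using ax[OF j] by'[OF j] by (auto simp: insert_commute)
    have "set (Q j) \<inter> set (rev (N j)) = {}" using q(4) n(4) d by auto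
    then have P23: "graph_path V E (x j) (Q j @ rev (N j)) d"
      using graph_path_append[OF P2 P3 e(1)] by simp
    have "set (L j) \<inter> set (Q j @ rev (N j)) = {}" using l(4) q(4) n(4) d by auto
    then have "graph_path V E c (T j) d"
      using graph_path_append[OF P1 P23 e(2)] by (simp add: T_def)
    moreover have "length (L j) \<ge> 1" "length (Q j) \<ge> 1" "length (N j) \<ge> 1"
      using l(1) q(1) n(1) by (simp_all add: Suc_leI)
    ultimately show ?thesis by (simp add: T_def)
  qed
  have int: "set (T i) \<inter> set (T j) = {c, d}" if ij: "i \<in> J" "j \<in> J" "i \<noteq> j" for i j
  proof -
    have d: "M 0 \<inter> M j = {}" "M 1 \<inter> M j = {}" "M 0 \<inter> M i = {}" "M 1 \<inter> M i = {}" "M 0 \<inter> M 1 = {}" "M i \<inter> M j = {}"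
      using Md[of 0 j] Md[of 1 j] Md[of 0 i] Md[of 1 i] Md[of 0 1] Md[of i j] J5[OF ij(1)] J5[OF ij(2)] ij(3)
      by simp_all
    have s: "set (L i) \<subseteq> M 0" "set (L j) \<subseteq> M 0" "set (Q i) \<subseteq> M i" "set (Q j) \<subseteq> M j"
      "set (N i) \<subseteq> M 1" "set (N j) \<subseteq> M 1"
      using graph_pathD(4)[OF L(1)] graph_pathD(4)[OF Q] graph_pathD(4)[OF N(1)] ij by simp_all
    have z: "set (L i) \<inter> set (Q j) = {}" "set (L i) \<inter> set (N j) = {}" "set (Q i) \<inter> set (L j) = {}"
      "set (Q i) \<inter> set (Q j) = {}" "set (Q i) \<inter> set (N j) = {}" "set (N i) \<inter> set (L j) = {}" "set (N i) \<inter> set (Q j) = {}"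
      using s d by blast+
    show ?thesis using L2[OF ij] N2[OF ij] z by (simp add: T_def Int_Un_distrib Int_Un_distrib2 insert_commute)
  qed
  have "c \<in> M 0" "d \<in> M 1"
    using graph_pathD(4,7)[OF L(1)[of 2]] graph_pathD(4,7)[OF N(1)[of 2]] by (auto simp: J_def)
  then have "c \<noteq> d" using Md[of 0 1] by auto
  then show False
    using no_three_paths[of c d "T 2" "T 3" "T 4"] T[of 2] T[of 3] T[of 4] int[of 2 3] int[of 2 4] int[of 3 4]
    by (simp add: J_def)
qed

lemma no_K4_minor: "\<not> has_minor V E 4 K4"
proof
  assume "has_minor V E 4 K4"
  then obtain M where M0: "\<forall>i<4. M i \<subseteq> V \<and> conn E (M i)"
    "\<forall>i<4. \<forall>j<4. i \<noteq> j \<longrightarrow> M i \<inter> M j = {}" "\<forall>(i, j)\<in>K4. touch E (M i) (M j)"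
    unfolding has_minor_def by (elim exE conjE)
  define J :: "nat \<Rightarrow> nat set" where "J i = {..<4} - {i}" for i
  have J: "card (J i) = 3" if "i < 4" for i using that by (simp add: J_def)
  have M: "M i \<subseteq> V" "conn E (M i)" if "i < 4" for i using M0(1) that by auto
  have Md: "M i \<inter> M j = {}" if "i < 4" "j < 4" "i \<noteq> j" for i j using M0(2) that by simp
  have Mt: "touch E (M i) (M j)" if "i < j" "j < 4" for i j
    using M0(3) that by (auto simp: K4_def)
  \<comment> \<open>The edge chosen between the sets \<open>M i\<close> and \<open>M j\<close> has the ends \<open>a i j\<close> and \<open>a j i\<close>.\<close>
  have "\<forall>i j. \<exists>xy. i < j \<and> j < 4 \<longrightarrow> fst xy \<in> M i \<and> snd xy \<in> M j \<and> {fst xy, snd xy} \<in> E"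
  proof (intro allI)
    fix i j
    show "\<exists>xy. i < j \<and> j < 4 \<longrightarrow> fst xy \<in> M i \<and> snd xy \<in> M j \<and> {fst xy, snd xy} \<in> E"
    proof (cases "i < j \<and> j < 4")
      case True
      then obtain x y where "x \<in> M i" "y \<in> M j" "{x, y} \<in> E"
        using Mt[of i j] unfolding touch_def by auto
      then show ?thesis by (intro exI[of _ "(x, y)"]) simp
    qed blast
  qed
  then obtain h where h: "\<And>i j. i < j \<Longrightarrow> j < 4 \<Longrightarrow>
      fst (h i j) \<in> M i \<and> snd (h i j) \<in> M j \<and> {fst (h i j), snd (h i j)} \<in> E"
    by metis
  define a where "a i j = (if i < j then fst (h i j) else snd (h j i))" for i j
  have a: "a i j \<in> M i" "{a i j, a j i} \<in> E" if ij: "i < 4" "j < 4" "i \<noteq> j" for i j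
  proof -
    consider "i < j" | "j < i" using ij(3) by linarith
    then have "a i j \<in> M i \<and> {a i j, a j i} \<in> E"
    proof cases
      case 1
      then show ?thesis using h[OF 1 ij(2)] by (simp add: a_def)
    next
      case 2
      then show ?thesis using h[OF 2 ij(1)] by (simp add: a_def insert_commute)
    qed
    then show "a i j \<in> M i" "{a i j, a j i} \<in> E" by auto
  qed
  have "\<exists>c L. (\<forall>j\<in>J i. graph_path (M i) E c (L j) (a i j)) \<and>
      (\<forall>j\<in>J i. \<forall>k\<in>J i. j \<noteq> k \<longrightarrow> set (L j) \<inter> set (L k) = {c})" if i: "i < 4" for i
  proof -
    have "a i j \<in> M i" if "j \<in> J i" for j using a(1)[of i j] i that by (auto simp: J_def)
    from conn_tripod_family[OF M(2)[OF i] J[OF i], of "a i", OF this] show ?thesis .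
  qed
  then have "\<forall>i\<in>{..<4}. \<exists>c. \<exists>L. (\<forall>j\<in>J i. graph_path (M i) E c (L j) (a i j)) \<and>
      (\<forall>j\<in>J i. \<forall>k\<in>J i. j \<noteq> k \<longrightarrow> set (L j) \<inter> set (L k) = {c})" by simp
  from bchoice[OF this] obtain q where
    "\<forall>i\<in>{..<4}. \<exists>L. (\<forall>j\<in>J i. graph_path (M i) E (q i) (L j) (a i j)) \<and>
      (\<forall>j\<in>J i. \<forall>k\<in>J i. j \<noteq> k \<longrightarrow> set (L j) \<inter> set (L k) = {q i})" by (elim exE)
  from bchoice[OF this] obtain L where
    "\<forall>i\<in>{..<4}. (\<forall>j\<in>J i. graph_path (M i) E (q i) (L i j) (a i j)) \<and>
      (\<forall>j\<in>J i. \<forall>k\<in>J i. j \<noteq> k \<longrightarrow> set (L i j) \<inter> set (L i k) = {q i})" by (elim exE)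
  then have qL: "(\<forall>j\<in>J i. graph_path (M i) E (q i) (L i j) (a i j)) \<and>
      (\<forall>j\<in>J i. \<forall>k\<in>J i. j \<noteq> k \<longrightarrow> set (L i j) \<inter> set (L i k) = {q i})" if "i < 4" for i
    using that by simp
  have L: "graph_path (M i) E (q i) (L i j) (a i j)" if "i < 4" "j < 4" "i \<noteq> j" for i j
    using qL[OF that(1)] that by (simp add: J_def)
  have Lint: "set (L i j) \<inter> set (L i k) = {q i}" if "i < 4" "j < 4" "i \<noteq> j" "k < 4" "i \<noteq> k" "j \<noteq> k" for i j k
  proof -
    have "j \<in> J i" "k \<in> J i" using that by (auto simp: J_def)
    then show ?thesis using qL[OF that(1)] that(6) by simp
  qed
  have Lsub: "set (L i j) \<subseteq> M i" if "i < 4" "j < 4" "i \<noteq> j" for i j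
    using graph_pathD(4)[OF L[OF that]] .
  have Ldis: "set (L i j) \<inter> set (L k l) = {}" if "i < 4" "j < 4" "i \<noteq> j" "k < 4" "l < 4" "k \<noteq> l" "i \<noteq> k" for i j k l
    using Lsub[OF that(1-3)] Lsub[OF that(4-6)] Md[OF that(1,4,7)] by blast
  have qM: "q i \<in> M i" if "i < 4" for i
  proof -
    define j :: nat where "j = (if i = 0 then 1 else 0)"
    have "graph_path (M i) E (q i) (L i j) (a i j)" by (rule L) (use that in \<open>auto simp: j_def\<close>)
    from graph_pathD(4,7)[OF this] show ?thesis by auto
  qed
  have qinj: "inj_on q {..<4}"
  proof (rule inj_onI)
    fix i j :: nat assume "i \<in> {..<4}" "j \<in> {..<4}" "q i = q j"
    then show "i = j" using Md[of i j] qM[of i] qM[of j] by auto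
  qed
  define P where "P i j = L i j @ rev (L j i)" for i j
  have P: "graph_path V E (q i) (P i j) (q j)" if ij: "i < 4" "j < 4" "i \<noteq> j" for i j
    unfolding P_def
  proof (rule graph_path_append)
    show "graph_path V E (q i) (L i j) (a i j)"
      using graph_path_mono[OF L[OF ij] M(1)[OF ij(1)]] .
    show "graph_path V E (a j i) (rev (L j i)) (q j)"
      using graph_path_rev[OF graph_path_mono[OF L[of j i] M(1)[of j]]] ij by simp
    show "{a i j, a j i} \<in> E" using a ij by simp
    show "set (L i j) \<inter> set (rev (L j i)) = {}" using Ldis[of i j j i] ij by simp
  qed
  show False
  proof (rule no_K4_subdivision[OF qinj P])
    show "P j i = rev (P i j)" for i j by (simp add: P_def)
    fix i j k l :: nat
    assume A: "i < 4" "j < 4" "k < 4" "l < 4" "i \<noteq> j" "k \<noteq> l" "{i, j} \<noteq> {k, l}"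
    have gen: "set (L i j) \<inter> set (L k l) = (if i = k then {q i} else {})"
      if "i < 4" "j < 4" "k < 4" "l < 4" "i \<noteq> j" "k \<noteq> l" "{i, j} \<noteq> {k, l}" for i j k l
    proof (cases "i = k")
      case True
      then have "j \<noteq> l" using that by auto
      then show ?thesis using Lint[of i j l] that True by simp
    next
      case False
      then show ?thesis using Ldis[of i j k l] that by simp
    qed
    have "set (P i j) \<inter> set (P k l) =
        (if i = k then {q i} else {}) \<union> (if i = l then {q i} else {}) \<union>
        ((if j = k then {q j} else {}) \<union> (if j = l then {q j} else {}))"
      using gen[of i j k l] gen[of i j l k] gen[of j i k l] gen[of j i l k] A
      by (simp add: P_def Int_Un_distrib Int_Un_distrib2 insert_commute Un_ac)
    also have "\<dots> = q ` ({i, j} \<inter> {k, l})" using A(5,6)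
      by (cases "i = k"; cases "i = l"; cases "j = k"; cases "j = l"; simp add: insert_commute)
    finally show "set (P i j) \<inter> set (P k l) = q ` ({i, j} \<inter> {k, l})" .
  qed simp_all
qed

end

lemma outerplanar_minor_free:
  assumes "finite_simple_graph V E" "outerplanar V E"
  shows "minor_free V E"
proof -
  obtain p g where "plane_drawing V E p g" "p ` V \<subseteq> frontier (outside (drawing_image V E p g))"
    using assms(2) unfolding outerplanar_def by blast
  then interpret outer_drawing V E p g using assms(1) by unfold_locales
  show ?thesis using no_K23_minor no_K4_minor by (simp add: minor_free_def)
qed

section \<open>Vertices of degree at most two\<close>

text \<open>The neighbourhood of a vertex.\<close>

definition nbrs :: "'a set set \<Rightarrow> 'a \<Rightarrow> 'a set" where
  "nbrs E v = {w. {v, w} \<in> E}"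

lemma edge_in_graph:
  assumes "finite_simple_graph V E" "{x, y} \<in> E"
  shows "x \<in> V" "y \<in> V" "x \<noteq> y"
proof -
  have "{x, y} \<subseteq> V \<and> card {x, y} = 2" using assms unfolding finite_simple_graph_def by blast
  then show "x \<in> V" "y \<in> V" "x \<noteq> y" by (auto simp: card_insert_if split: if_splits)
qed

lemma nbrs_subset: "finite_simple_graph V E \<Longrightarrow> nbrs E v \<subseteq> V"
  by (auto simp: nbrs_def dest: edge_in_graph)

lemma finite_nbrs: "finite_simple_graph V E \<Longrightarrow> finite (nbrs E v)"
  using finite_subset[OF nbrs_subset[of V E v]] by (simp add: finite_simple_graph_def)

lemma not_nbr_self: "finite_simple_graph V E \<Longrightarrow> v \<notin> nbrs E v"
  using edge_in_graph(3)[of V E v v] by (auto simp: nbrs_def)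

lemma nbrs_sym: "w \<in> nbrs E v \<longleftrightarrow> v \<in> nbrs E w"
  by (simp add: nbrs_def insert_commute)

lemma vdegree_eq_card_nbrs:
  assumes G: "finite_simple_graph V E"
  shows "vdegree E v = card (nbrs E v)"
proof -
  have "{e \<in> E. v \<in> e} = (\<lambda>w. {v, w}) ` nbrs E v"
  proof
    show "{e \<in> E. v \<in> e} \<subseteq> (\<lambda>w. {v, w}) ` nbrs E v"
    proof
      fix e assume e: "e \<in> {e \<in> E. v \<in> e}"
      then have "card e = 2" using G by (simp add: finite_simple_graph_def)
      then obtain x y where xy: "e = {x, y}" by (auto simp: card_2_iff)
      show "e \<in> (\<lambda>w. {v, w}) ` nbrs E v"
      proof (cases "v = x")
        case True
        then show ?thesis using e xy by (auto simp: nbrs_def)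
      next
        case False
        then have "v = y" using e xy by simp
        then have "e = {v, x}" using xy by (simp add: insert_commute)
        then show ?thesis using e by (auto simp: nbrs_def)
      qed
    qed
    show "(\<lambda>w. {v, w}) ` nbrs E v \<subseteq> {e \<in> E. v \<in> e}" by (auto simp: nbrs_def)
  qed
  moreover have "inj_on (\<lambda>w. {v, w}) (nbrs E v)"
    by (auto simp: inj_on_def doubleton_eq_iff)
  ultimately show ?thesis by (simp add: vdegree_def card_image)
qed

lemma touch_singleton_iff: "touch E {x} Y \<longleftrightarrow> nbrs E x \<inter> Y \<noteq> {}"
  by (auto simp: touch_def nbrs_def)

text \<open>Let \<open>L\<close> be the last layer of a breadth-first search, \<open>B\<close> the union of the earlier layers, and
  \<open>Pa\<close> the set of parents, the vertices of \<open>B\<close> adjacent to \<open>L\<close>. Unless there is at most one parent,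
  the layers before them form a connected set \<open>S\<close> adjacent to all parents.

  Take a longest path in \<open>L\<close>. Its first vertex has at most one neighbour in \<open>L\<close>: a second one would
  close a cycle, which together with \<open>B\<close> gives a \<open>K\<^sub>4\<close> minor. The path has at most two parents, as
  three of them together with the path and \<open>S\<close> give a \<open>K\<^sub>2\<^sub>,\<^sub>3\<close> minor. So if all degrees in \<open>L\<close> were
  at least 3, both ends of the path would be adjacent to the same two parents, and these two
  parents, the first vertex, the rest of the path and \<open>S\<close> would give a \<open>K\<^sub>2\<^sub>,\<^sub>3\<close> minor.\<close>

lemma layer_has_low_vertex:
  assumes G: "finite_simple_graph V E" and mf: "minor_free V E"
    and B: "conn E B" "B \<subseteq> V" and L: "L \<subseteq> V" "L \<noteq> {}" "B \<inter> L = {}"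
    and down: "\<And>u. u \<in> L \<Longrightarrow> touch E {u} B"
    and up: "\<And>u. u \<in> L \<Longrightarrow> nbrs E u \<subseteq> B \<union> L"
    and Pa: "Pa = {p \<in> B. touch E {p} L}"
    and S: "(\<exists>b. Pa \<subseteq> {b}) \<or> (\<exists>S\<subseteq>B. conn E S \<and> S \<inter> Pa = {} \<and> (\<forall>p\<in>Pa. touch E {p} S))"
  shows "\<exists>u\<in>L. card (nbrs E u) \<le> 2"
proof (rule ccontr)
  assume "\<not> ?thesis"
  then have contra: "\<forall>u\<in>L. \<not> card (nbrs E u) \<le> 2" by simp
  have deg: "card (nbrs E u) \<ge> 3" if "u \<in> L" for u using bspec[OF contra that] by simp
  have noK23: "\<not> has_minor V E 5 K23" and noK4: "\<not> has_minor V E 4 K4"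
    using mf by (simp_all add: minor_free_def)
  have finV: "finite V" using G by (simp add: finite_simple_graph_def)
  have finL: "finite L" "finite B" using finite_subset[OF L(1) finV] finite_subset[OF B(2) finV] by simp_all
  have below: "\<exists>S. S \<subseteq> B \<and> conn E S \<and> S \<inter> Pa = {} \<and> (\<forall>p\<in>Pa. touch E {p} S)"
    if "a \<in> Pa" "b \<in> Pa" "a \<noteq> b" for a b
    using S
  proof
    assume "\<exists>b. Pa \<subseteq> {b}"
    then obtain c where c: "Pa \<subseteq> {c}" by (elim exE)
    have "a = c" "b = c" using subsetD[OF c that(1)] subsetD[OF c that(2)] by simp_all
    then show ?thesis using that(3) by simp
  next
    assume "\<exists>S\<subseteq>B. conn E S \<and> S \<inter> Pa = {} \<and> (\<forall>p\<in>Pa. touch E {p} S)"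
    then show ?thesis .
  qed
  let ?P = "\<lambda>xs. xs \<noteq> [] \<and> distinct xs \<and> set xs \<subseteq> L \<and> ledges xs \<subseteq> E"
  obtain u0 where "u0 \<in> L" using L(2) by auto
  then have P0: "?P [u0]" by simp
  have bound: "\<forall>ys. ?P ys \<longrightarrow> length ys < Suc (card L)"
  proof (intro allI impI)
    fix ys assume ys: "?P ys"
    then have "card (set ys) \<le> card L" using finL(1) by (intro card_mono) auto
    then show "length ys < Suc (card L)" using ys by (simp add: distinct_card)
  qed
  from Lattices_Big.ex_has_greatest_nat[of ?P, OF P0 bound]
  obtain xs where xs: "?P xs" and max: "\<forall>ys. ?P ys \<longrightarrow> length ys \<le> length xs"
    by (erule_tac exE, erule_tac conjE, rule_tac that)
  define Q where "Q = set xs"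
  define PQ where "PQ = {p \<in> B. touch E {p} Q}"
  have Q: "Q \<subseteq> L" "conn E Q" using xs conn_set_walk[of xs E] by (auto simp: Q_def)
  have PQPa: "PQ \<subseteq> Pa" using touch_mono[OF _ subset_refl Q(1)] by (auto simp: PQ_def Pa)
  have PQB: "PQ \<subseteq> B" "finite PQ" using finL(2) by (auto simp: PQ_def)
  have PQ2: "card PQ \<le> 2"
  proof (rule ccontr)
    assume "\<not> ?thesis"
    then have "card PQ \<ge> 3" by simp
    then obtain T where T: "T \<subseteq> PQ" "card T = 3" using obtain_subset_with_card_n by metis
    then obtain p1 p2 p3 where p: "T = {p1, p2, p3}" "p1 \<noteq> p2" "p2 \<noteq> p3" "p1 \<noteq> p3"
      unfolding card_3_iff by blast
    have pPQ: "p1 \<in> PQ" "p2 \<in> PQ" "p3 \<in> PQ" using p T by auto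
    obtain S where S: "S \<subseteq> B" "conn E S" "S \<inter> Pa = {}" "\<forall>p\<in>Pa. touch E {p} S"
      using below[OF subsetD[OF PQPa pPQ(1)] subsetD[OF PQPa pPQ(2)] p(2)] by (elim exE conjE)
    have tS: "touch E S {p1}" "touch E S {p2}" "touch E S {p3}"
      using S(4) pPQ PQPa touch_sym[of E S] by auto
    have tQ: "touch E Q {p1}" "touch E Q {p2}" "touch E Q {p3}"
      using pPQ touch_sym[of E Q] by (auto simp: PQ_def)
    have disj: "S \<inter> {p1} = {}" "S \<inter> {p2} = {}" "S \<inter> {p3} = {}" using S(3) pPQ PQPa by auto
    have disj2: "Q \<inter> {p1} = {}" "Q \<inter> {p2} = {}" "Q \<inter> {p3} = {}" "Q \<inter> S = {}"
      using Q(1) L(3) pPQ PQB S(1) by auto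
    have sub: "Q \<subseteq> V" "S \<subseteq> V" "p1 \<in> V" "p2 \<in> V" "p3 \<in> V"
      using Q(1) L(1) S(1) B(2) pPQ PQB(1) by auto
    have "has_minor V E 5 K23"
      by (rule K23_minorI[of Q V S "{p1}" "{p2}" "{p3}"])
        (use sub Q(2) S(2) p(2,3,4) tS tQ disj disj2 in simp_all)
    then show False using noK23 by simp
  qed
  \<comment> \<open>The two ends of a longest path in the layer have the same two neighbours below the layer.\<close>
  have ends: "nbrs E (hd ys) \<inter> B = PQ \<and> card PQ = 2 \<and> tl ys \<noteq> []"
    if ys: "?P ys" and len: "length ys = length xs" and sY: "set ys = Q" for ys
  proof -
    obtain q zs where qz: "ys = q # zs" using ys by (cases ys) auto
    have qL: "q \<in> L" "q \<in> Q" using ys sY qz by auto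
    have nL: "w = hd zs \<and> zs \<noteq> []" if w: "w \<in> nbrs E q \<inter> L" for w
    proof -
      have wq: "{q, w} \<in> E" "w \<noteq> q" "w \<in> L" using w not_nbr_self[OF G] by (auto simp: nbrs_def)
      have "w \<in> set ys"
      proof (rule ccontr)
        assume "w \<notin> set ys"
        then have "?P (w # ys)" using ys wq qz by (auto simp: insert_commute)
        moreover have "?P (w # ys) \<longrightarrow> length (w # ys) \<le> length xs" using max by (rule spec)
        ultimately have "length (w # ys) \<le> length xs" by (rule_tac mp)
        then show False using len by simp
      qed
      then have "w \<in> set zs" using qz wq by auto
      then obtain us vs where uv: "zs = us @ w # vs" by (auto simp: in_set_conv_decomp)
      have "us = []"
      proof (rule ccontr)
        assume us: "us \<noteq> []"
        have ys': "ys = q # us @ w # vs" using qz uv by simp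
        have l1: "ledges ys = insert {q, hd us} (insert {last us, w} (ledges us \<union> ledges (w # vs)))"
          using ledges_append[of "[q]" "us @ w # vs"] ledges_append[of us "w # vs"] us ys'
          by (simp add: hd_append)
        then have e: "{q, hd us} \<in> E" "{last us, w} \<in> E" "ledges us \<subseteq> E" using ys by auto
        have sub: "set us \<subseteq> L" "q \<notin> set us" "w \<notin> set us" using ys ys' by auto
        have tB: "touch E {q} B" "touch E (set us) B" "touch E {w} B"
        proof -
          show "touch E {q} B" "touch E {w} B" using down qL wq by auto
          have "touch E {hd us} B" using down[of "hd us"] sub us by (simp add: subset_iff)
          then show "touch E (set us) B" by (rule touch_mono) (use us in auto)
        qed
        have "touch E {q} (set us)" using e us by (auto intro!: touchI[of q "hd us"])
        moreover have "touch E (set us) {w}" using e us by (auto intro!: touchI[of "last us" w])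
        moreover have "touch E {q} {w}" using wq by (auto intro!: touchI)
        moreover have "conn E (set us)" using conn_set_walk[OF us] e by simp
        moreover have "q \<in> V" "w \<in> V" "set us \<subseteq> V" "q \<notin> B" "w \<notin> B" "set us \<inter> B = {}"
          using qL(1) wq sub(1) L(1,3) by auto
        ultimately have "has_minor V E 4 K4"
          by (intro K4_minorI[of "{q}" V "set us" "{w}" B]) (use B tB sub(2,3) wq(2) in simp_all)
        then show False using noK4 by simp
      qed
      then show ?thesis using uv by simp
    qed
    have split: "nbrs E q = (nbrs E q \<inter> B) \<union> (nbrs E q \<inter> L)" using up[OF qL(1)] by auto
    have sub: "nbrs E q \<inter> B \<subseteq> PQ"
    proof
      fix p assume p: "p \<in> nbrs E q \<inter> B"
      then have "{p, q} \<in> E" by (simp add: nbrs_def insert_commute)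
      then have "touch E {p} Q" using qL(2) by (auto intro!: touchI)
      then show "p \<in> PQ" using p by (simp add: PQ_def)
    qed
    have c1: "card (nbrs E q \<inter> B) \<le> card PQ" using sub PQB card_mono by auto
    have "nbrs E q \<inter> L \<subseteq> {hd zs}" using nL by auto
    then have c2: "card (nbrs E q \<inter> L) \<le> 1" using card_mono[of "{hd zs}"] by fastforce
    have c3: "3 \<le> card (nbrs E q \<inter> B) + card (nbrs E q \<inter> L)"
      using deg[OF qL(1)] split card_Un_le[of "nbrs E q \<inter> B" "nbrs E q \<inter> L"] by simp
    then have "card (nbrs E q \<inter> L) \<noteq> 0" "card (nbrs E q \<inter> B) = card PQ" "card PQ = 2"
      using c1 c2 PQ2 by linarith+
    then have "nbrs E q \<inter> L \<noteq> {}" "nbrs E q \<inter> B = PQ"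
      using card_subset_eq[OF PQB(2) sub] by (auto simp del: card_0_eq)
    then show ?thesis using nL \<open>card PQ = 2\<close> qz by auto
  qed
  have e1: "nbrs E (hd xs) \<inter> B = PQ" "card PQ = 2" "tl xs \<noteq> []"
    using ends[OF xs] by (simp_all add: Q_def)
  have "?P (rev xs)" using xs by (simp add: ledges_rev)
  then have e2: "nbrs E (hd (rev xs)) \<inter> B = PQ" using ends[of "rev xs"] by (simp add: Q_def)
  obtain a b where ab: "PQ = {a, b}" "a \<noteq> b" using e1(2) by (auto simp: card_2_iff)
  obtain q zs where qz: "xs = q # zs" "zs \<noteq> []" using xs e1(3) by (cases xs) auto
  have nq: "{q, a} \<in> E" "{q, b} \<in> E" using e1(1) ab qz by (auto simp: nbrs_def)
  have nl: "{last zs, a} \<in> E" "{last zs, b} \<in> E" using e2 ab qz by (auto simp: nbrs_def hd_rev)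
  have abPa: "a \<in> Pa" "b \<in> Pa" using ab PQPa by auto
  obtain S where S: "S \<subseteq> B" "conn E S" "S \<inter> Pa = {}" "\<forall>p\<in>Pa. touch E {p} S"
    using below[OF abPa ab(2)] by (elim exE conjE)
  have zs: "q \<in> L" "set zs \<subseteq> L" "q \<notin> set zs" using xs qz by auto
  have "ledges xs = insert {q, hd zs} (ledges zs)" using qz by (cases zs) auto
  then have "conn E (set zs)" using conn_set_walk[OF qz(2)] xs by simp
  moreover have "touch E {a} {q}" "touch E {b} {q}" using nq by (auto simp: touch_def insert_commute)
  moreover have "touch E {a} (set zs)" "touch E {b} (set zs)"
    using nl qz(2) touchI[of a "last zs" E "{a}" "set zs"] touchI[of b "last zs" E "{b}" "set zs"]
    by (simp_all add: insert_commute)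
  moreover have "a \<in> B" "b \<in> B" "a \<notin> S" "b \<notin> S" using ab PQB abPa S(3) by auto
  moreover have "S \<inter> L = {}" "a \<notin> L" "b \<notin> L" using S(1) L(3) \<open>a \<in> B\<close> \<open>b \<in> B\<close> by auto
  moreover have "set zs \<inter> S = {}" "q \<notin> S" using \<open>S \<inter> L = {}\<close> zs by auto
  moreover have "touch E {a} S" "touch E {b} S" using S(4) abPa by auto
  moreover have V: "a \<in> V" "b \<in> V" "S \<subseteq> V" "q \<in> V" "set zs \<subseteq> V"
    using \<open>a \<in> B\<close> \<open>b \<in> B\<close> S(1) B(2) L(1) zs by auto
  moreover have ne: "a \<noteq> q" "b \<noteq> q" "a \<notin> set zs" "b \<notin> set zs"
    using \<open>a \<notin> L\<close> \<open>b \<notin> L\<close> zs by auto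
  ultimately have "has_minor V E 5 K23"
    by (intro K23_minorI[of "{a}" V "{b}" "{q}" "set zs" S]) (use V S(2) zs(3) \<open>a \<noteq> b\<close> ne in simp_all)
  then show False using noK23 by simp
qed

text \<open>There is a vertex of degree at most 2 whose neighbours remain connected when it is removed:
  any vertex of degree at most 2 in the last layer of a breadth-first search will do.\<close>

lemma low_noncut_vertex:
  assumes G: "finite_simple_graph V E" and mf: "minor_free V E" and "V \<noteq> {}"
  shows "\<exists>u\<in>V. card (nbrs E u) \<le> 2 \<and>
    (nbrs E u = {} \<or> (\<exists>X\<subseteq>V. conn E X \<and> nbrs E u \<subseteq> X \<and> u \<notin> X))"
proof -
  obtain r where r: "r \<in> V" using assms(3) by auto
  have finV: "finite V" using G by (simp add: finite_simple_graph_def)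
  \<comment> \<open>The balls around \<open>r\<close>.\<close>
  define R where "R = rec_nat {r} (\<lambda>_ X. X \<union> (\<Union>x\<in>X. nbrs E x))"
  have R0: "R 0 = {r}" and RS: "R (Suc n) = R n \<union> (\<Union>x\<in>R n. nbrs E x)" for n
    by (simp_all add: R_def)
  have RV: "R n \<subseteq> V" for n
  proof (induction n)
    case (Suc n)
    then show ?case using nbrs_subset[OF G] by (simp add: RS UN_least)
  qed (simp add: R0 r)
  have Rtouch: "touch E {w} (R n)" if "w \<in> R (Suc n)" "w \<notin> R n" for w n
    using that by (auto simp: RS touch_singleton_iff nbrs_sym[of w])
  have Rconn: "conn E (R n)" for n
  proof (induction n)
    case (Suc n)
    have "R (Suc n) = R n \<union> (R (Suc n) - R n)" by (auto simp: RS)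
    then show ?case using conn_attach[OF Suc, of "R (Suc n) - R n"] Rtouch by auto
  qed (simp add: R0)
  have "\<exists>n. R (Suc n) = R n"
  proof (rule ccontr)
    assume "\<not> ?thesis"
    then have strict: "R n \<subset> R (Suc n)" for n by (auto simp: RS)
    have "n \<le> card (R n)" for n
    proof (induction n)
      case (Suc n)
      have "card (R n) < card (R (Suc n))"
        using psubset_card_mono[OF finite_subset[OF RV finV] strict] .
      then show ?case using Suc by simp
    qed simp
    then have "Suc (card V) \<le> card (R (Suc (card V)))" .
    moreover have "card (R (Suc (card V))) \<le> card V" using card_mono[OF finV RV] .
    ultimately show False by simp
  qed
  then obtain m where m: "R (Suc m) = R m" "\<forall>n<m. R (Suc n) \<noteq> R n"
    using exists_least_iff[of "\<lambda>n. R (Suc n) = R n"] by auto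
  show ?thesis
  proof (cases m)
    case 0
    then have "nbrs E r \<subseteq> {r}" using m(1) by (auto simp: RS R0)
    then have "nbrs E r = {}" using not_nbr_self[OF G, of r] by auto
    then show ?thesis using r by (intro bexI[of _ r]) auto
  next
    case (Suc n)
    define B where "B = R n"
    define L where "L = R m - R n"
    have Rm: "R m = B \<union> L" by (auto simp: B_def L_def Suc RS)
    have down: "touch E {u} B" if "u \<in> L" for u
      using that Rtouch by (simp add: L_def B_def Suc)
    have up: "nbrs E u \<subseteq> B \<union> L" if "u \<in> L" for u
    proof -
      have "u \<in> R m" using that by (simp add: L_def)
      then have "nbrs E u \<subseteq> R (Suc m)" by (auto simp: RS)
      then show ?thesis using m(1) Rm by simp
    qed
    have Lne: "L \<noteq> {}" using m(2) Suc by (auto simp: L_def RS)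
    have LV: "L \<subseteq> V" using RV[of m] by (auto simp: L_def)
    define Pa where "Pa = {p \<in> B. touch E {p} L}"
    have "(\<exists>b. Pa \<subseteq> {b}) \<or> (\<exists>S\<subseteq>B. conn E S \<and> S \<inter> Pa = {} \<and> (\<forall>p\<in>Pa. touch E {p} S))"
    proof (cases n)
      case 0
      then have "Pa \<subseteq> {r}" by (auto simp: Pa_def B_def R0)
      then show ?thesis by auto
    next
      case n: (Suc k)
      have d: "R k \<inter> Pa = {}"
      proof (rule ccontr)
        assume "R k \<inter> Pa \<noteq> {}"
        then obtain p u where "p \<in> R k" "u \<in> nbrs E p" "u \<in> L"
          by (auto simp: Pa_def touch_singleton_iff)
        then show False by (auto simp: L_def n RS)
      qed
      have "touch E {p} (R k)" if "p \<in> Pa" for p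
        using that d Rtouch[of p k] by (auto simp: Pa_def B_def n)
      moreover have "R k \<subseteq> B" by (auto simp: B_def n RS)
      ultimately show ?thesis using d Rconn[of k] by blast
    qed
    then obtain u where u: "u \<in> L" "card (nbrs E u) \<le> 2"
      using layer_has_low_vertex[OF G mf _ _ LV Lne _ down up Pa_def] Rconn[of n] RV[of n]
      by (auto simp: B_def L_def)
    define X where "X = B \<union> (L - {u})"
    have "conn E X" unfolding X_def using Rconn[of n] by (intro conn_attach down) (auto simp: B_def)
    moreover have "nbrs E u \<subseteq> X" using up[OF u(1)] not_nbr_self[OF G, of u] by (auto simp: X_def)
    moreover have "u \<notin> X" using u(1) by (simp add: X_def L_def B_def)
    moreover have "X \<subseteq> V" using RV[of n] LV by (auto simp: X_def B_def)
    ultimately show ?thesis using u LV by blast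
  qed
qed

section \<open>Smoothing vertices of degree two\<close>

text \<open>The edges that remain when the vertices of degree 2 in an independent set \<open>T\<close> are smoothed away:
  each of them is replaced by an edge between its two neighbours, and the vertex set becomes
  \<open>V - T\<close>. The neighbourhood of a vertex of \<open>T\<close> is itself this new edge. Edges that become parallel
  are identified.\<close>

definition smooth_edges :: "'a set \<Rightarrow> 'a set set \<Rightarrow> 'a set \<Rightarrow> 'a set set" where
  "smooth_edges V E T = {e \<in> E. e \<subseteq> V - T} \<union> nbrs E ` T"

text \<open>Smoothing is a contraction: every \<open>v \<in> T\<close> is contracted into a chosen neighbour \<open>s v\<close>, and
  \<open>fibre T s x\<close> is the set contracted into \<open>x\<close>.\<close>

definition fibre :: "'a set \<Rightarrow> ('a \<Rightarrow> 'a) \<Rightarrow> 'a \<Rightarrow> 'a set" where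
  "fibre T s x = insert x {v \<in> T. s v = x}"

lemma touch_common_nbr:
  assumes "nbrs E v = {u, w}"
  shows "touch E {u} {v}" "touch E {w} {v}"
proof -
  have "{v, u} \<in> E" "{v, w} \<in> E" using assms by (auto simp: nbrs_def)
  then show "touch E {u} {v}" "touch E {w} {v}" by (simp_all add: touch_def insert_commute)
qed

text \<open>An independent set \<open>T\<close> of vertices of degree 2.\<close>

locale smoothing =
  fixes V :: "'a set" and E :: "'a set set" and T :: "'a set"
  assumes graph: "finite_simple_graph V E" and TV: "T \<subseteq> V"
    and deg2: "\<And>v. v \<in> T \<Longrightarrow> card (nbrs E v) = 2"
    and indep: "\<And>v. v \<in> T \<Longrightarrow> nbrs E v \<inter> T = {}"
begin

abbreviation "E' \<equiv> smooth_edges V E T"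

lemma nbrs_T_subset: "v \<in> T \<Longrightarrow> nbrs E v \<subseteq> V - T"
  using indep[of v] nbrs_subset[OF graph, of v] by auto

lemma smooth_graph: "finite_simple_graph (V - T) E'"
proof -
  have "e \<subseteq> V - T \<and> card e = 2" if "e \<in> E'" for e
    using that graph nbrs_T_subset deg2 by (auto simp: smooth_edges_def finite_simple_graph_def)
  then show ?thesis using graph by (simp add: finite_simple_graph_def)
qed

lemma smooth_edge_cases:
  assumes "{x, y} \<in> E'"
  obtains "{x, y} \<in> E" | v where "v \<in> T" "nbrs E v = {x, y}"
  using assms by (auto simp: smooth_edges_def)

lemma conn_fibre:
  assumes "\<And>v. v \<in> T \<Longrightarrow> s v \<in> nbrs E v"
  shows "conn E (fibre T s x)"
proof -
  have "conn E ({x} \<union> {v \<in> T. s v = x})"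
  proof (rule conn_attach)
    fix v assume "v \<in> {v \<in> T. s v = x}"
    then show "touch E {v} {x}" using assms[of v] by (simp add: touch_singleton_iff)
  qed simp
  then show ?thesis by (simp add: fibre_def)
qed

lemma touch_fibre:
  assumes s: "\<And>v. v \<in> T \<Longrightarrow> s v \<in> nbrs E v" and xy: "{x, y} \<in> E'"
  shows "touch E (fibre T s x) (fibre T s y)"
  using xy
proof (cases rule: smooth_edge_cases)
  case 1
  then show ?thesis by (rule touchI) (simp_all add: fibre_def)
next
  case (2 v)
  have e: "{v, x} \<in> E" "{v, y} \<in> E" using 2(2) by (auto simp: nbrs_def)
  have "s v = x \<or> s v = y" using s[OF 2(1)] 2(2) by simp
  then show ?thesis
  proof
    assume "s v = x"
    then show ?thesis using e(2) by (intro touchI[of v y]) (simp_all add: fibre_def 2(1))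
  next
    assume "s v = y"
    then show ?thesis using e(1)
      by (intro touchI[of x v]) (simp_all add: fibre_def 2(1) insert_commute)
  qed
qed

lemma smooth_minor_free:
  assumes "minor_free V E"
  shows "minor_free (V - T) E'"
proof -
  define s where "s v = (SOME w. w \<in> nbrs E v)" for v
  have s: "s v \<in> nbrs E v" if "v \<in> T" for v
  proof -
    have "nbrs E v \<noteq> {}" using deg2[OF that] by auto
    then show ?thesis unfolding s_def by (simp add: some_in_eq)
  qed
  show ?thesis
  proof (rule minor_free_contract[OF assms])
    fix x assume "x \<in> V - T"
    then show "fibre T s x \<subseteq> V \<and> conn E (fibre T s x)"
      using TV conn_fibre[of s x] s by (auto simp: fibre_def)
  next
    fix x y assume "x \<in> V - T" "y \<in> V - T" "x \<noteq> y"
    then show "fibre T s x \<inter> fibre T s y = {}" by (auto simp: fibre_def)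
  next
    fix x y assume "{x, y} \<in> E'"
    then show "touch E (fibre T s x) (fibre T s y)" using touch_fibre[of s x y] s by simp
  qed
qed

text \<open>If \<open>v1\<close> and \<open>v2\<close> are smoothed away into the same edge \<open>{u, w}\<close>, then no connected set of the
  smoothed graph that avoids \<open>u\<close> and \<open>w\<close> touches both of them: its preimage, \<open>v1\<close> and \<open>v2\<close> would form
  the larger colour class of a \<open>K\<^sub>2\<^sub>,\<^sub>3\<close> minor.\<close>

lemma twin_paths_K23:
  assumes mf: "minor_free V E"
    and v: "v1 \<in> T" "v2 \<in> T" "v1 \<noteq> v2" "nbrs E v1 = {u, w}" "nbrs E v2 = {u, w}"
    and C: "conn E' C" "C \<subseteq> V - T" "u \<notin> C" "w \<notin> C"
    and t: "touch E' {u} C" "touch E' {w} C"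
  shows False
proof -
  \<comment> \<open>The vertices of \<open>T\<close> are contracted away from \<open>u\<close> and \<open>w\<close> wherever possible, so that the
    preimage of \<open>C\<close> still touches \<open>u\<close> and \<open>w\<close> themselves and not only their fibres.\<close>
  define s where "s v = (if nbrs E v = {u, w} then u else SOME y. y \<in> nbrs E v - {u, w})" for v
  have uw: "u \<noteq> w" using deg2[OF v(1)] v(4) by auto
  have s': "s x \<in> nbrs E x - {u, w}" if x: "x \<in> T" "nbrs E x \<noteq> {u, w}" for x
  proof -
    have "\<not> nbrs E x \<subseteq> {u, w}"
    proof
      assume "nbrs E x \<subseteq> {u, w}"
      then have "nbrs E x = {u, w}" using card_subset_eq[of "{u, w}" "nbrs E x"] deg2[OF x(1)] uw by simp
      then show False using x(2) by simp
    qed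
    then have "nbrs E x - {u, w} \<noteq> {}" by auto
    then have "(SOME y. y \<in> nbrs E x - {u, w}) \<in> nbrs E x - {u, w}" by (simp only: some_in_eq not_False_eq_True)
    moreover have "s x = (SOME y. y \<in> nbrs E x - {u, w})" unfolding s_def using x(2) by (rule if_not_P)
    ultimately show ?thesis by (simp only:)
  qed
  have s: "s x \<in> nbrs E x" if "x \<in> T" for x
  proof (cases "nbrs E x = {u, w}")
    case True
    then show ?thesis by (simp add: s_def)
  next
    case False
    then show ?thesis using s'[OF that] by simp
  qed
  define C' where "C' = (\<Union>x\<in>C. fibre T s x)"
  have conn: "conn E C'" unfolding C'_def
  proof (rule conn_UN[OF C(1)])
    fix x show "conn E (fibre T s x)" using conn_fibre[of s x] s by simp
  next
    fix x y assume "{x, y} \<in> E'"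
    then show "touch E (fibre T s x) (fibre T s y)" using touch_fibre[of s x y] s by simp
  qed
  have CC: "C \<subseteq> C'" by (auto simp: C'_def fibre_def)
  have uwV: "u \<in> V - T" "w \<in> V - T" using nbrs_T_subset[OF v(1)] v(4) by auto
  have notin: "u \<notin> C'" "w \<notin> C'" using uwV C(3,4) by (auto simp: C'_def fibre_def)
  have "s v1 = u" "s v2 = u" using v by (simp_all add: s_def)
  then have vnotin: "v1 \<notin> C'" "v2 \<notin> C'" using v(1,2) C(2,3) by (auto simp: C'_def fibre_def)
  have C'V: "C' \<subseteq> V" using C(2) TV by (auto simp: C'_def fibre_def)
  have tC: "touch E {a} C'" if a: "a = u \<or> a = w" and t: "touch E' {a} C" for a
  proof -
    obtain y where y: "y \<in> C" "{a, y} \<in> E'" using t by (auto simp: touch_def)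
    have yn: "y \<noteq> u" "y \<noteq> w" using y(1) C(3,4) by auto
    show ?thesis using y(2)
    proof (cases rule: smooth_edge_cases)
      case 1
      then show ?thesis by (rule touchI) (use y CC in auto)
    next
      case (2 x)
      have "nbrs E x \<noteq> {u, w}" using 2(2) yn by auto
      then have "s x \<in> {a, y} - {u, w}" using s'[OF 2(1)] 2(2) by simp
      then have "s x = y" using a by auto
      then have "x \<in> C'" using 2(1) y(1) by (auto simp: C'_def fibre_def)
      moreover have "{a, x} \<in> E" using 2(2) by (auto simp: nbrs_def insert_commute)
      ultimately show ?thesis by (intro touchI[of a x]) simp_all
    qed
  qed
  have tv: "touch E {u} {v1}" "touch E {u} {v2}" "touch E {w} {v1}" "touch E {w} {v2}"
    using touch_common_nbr[OF v(4)] touch_common_nbr[OF v(5)] by simp_all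
  have tuw: "touch E {u} C'" "touch E {w} C'" using tC[OF _ t(1)] tC[OF _ t(2)] by simp_all
  have ne: "u \<noteq> v1" "u \<noteq> v2" "w \<noteq> v1" "w \<noteq> v2" using uwV v(1,2) by auto
  have inV: "u \<in> V" "w \<in> V" "v1 \<in> V" "v2 \<in> V" using uwV v(1,2) TV by auto
  have "has_minor V E 5 K23"
    by (rule K23_minorI[of "{u}" V "{w}" "{v1}" "{v2}" C'])
      (use inV C'V conn uw ne notin vnotin v(3) tv tuw in simp_all)
  then show False using mf by (simp add: minor_free_def)
qed

end

lemma conn_avoid:
  assumes X: "conn E X" "z \<in> X" "w \<in> X" "z \<noteq> w"
  shows "\<exists>C. C \<subseteq> X - {w} \<and> conn E C \<and> z \<in> C \<and> touch E {w} C"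
proof -
  obtain xs where xs: "graph_path X E z xs w" using conn_graph_path[OF X(1-3)] by (elim exE)
  note p = graph_pathD[OF xs]
  define us where "us = butlast xs"
  have xs': "xs = us @ [w]" using p(1,3) append_butlast_last_id[of xs] by (simp add: us_def)
  have us: "us \<noteq> []" "hd us = z" using p(2) X(4) xs' by (auto simp: hd_append split: if_splits)
  have "ledges xs = insert {last us, w} (ledges us)" using ledges_append[of us "[w]"] us xs' by simp
  then have e: "{last us, w} \<in> E" "ledges us \<subseteq> E" using p(6) by auto
  have "touch E {w} (set us)" using e(1) us(1) by (intro touchI[of w "last us"]) (simp_all add: insert_commute)
  moreover have "conn E (set us)" by (rule conn_set_walk[OF us(1) e(2)])
  moreover have "set us \<subseteq> X - {w}" using p(4,5) xs' by auto
  moreover have "z \<in> set us" using us hd_in_set[of us] by simp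
  ultimately show ?thesis by (intro exI[of _ "set us"]) simp
qed

text \<open>Suppose that all neighbours of vertices of degree 2 have degree at least 5. Smooth away all
  vertices of degree 2 at once, and let \<open>u\<close> be a vertex as in \<open>low_noncut_vertex\<close> of the smoothed
  graph. If every edge at \<open>u\<close> in the smoothed graph comes from at most one edge and one smoothed
  vertex, \<open>u\<close> has degree at most 4 in the original graph. Otherwise two smoothed vertices share the
  neighbours \<open>u\<close> and \<open>w\<close>. If \<open>w\<close> is the only neighbour of \<open>u\<close> in the smoothed graph, the large degree
  of \<open>u\<close> provides a third such vertex and hence a \<open>K\<^sub>2\<^sub>,\<^sub>3\<close>. If there is another neighbour, the choice
  of \<open>u\<close> connects it with \<open>w\<close>, against \<open>twin_paths_K23\<close>.\<close>

lemma degree_two_vertex_with_light_neighbour: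
  assumes G: "finite_simple_graph V E" and mf: "minor_free V E" and ne: "V \<noteq> {}"
    and min2: "\<And>v. v \<in> V \<Longrightarrow> card (nbrs E v) \<ge> 2"
  shows "\<exists>v\<in>V. card (nbrs E v) = 2 \<and> (\<exists>u\<in>nbrs E v. card (nbrs E u) \<le> 4)"
proof (rule ccontr)
  assume contra: "\<not> ?thesis"
  define T where "T = {v \<in> V. card (nbrs E v) = 2}"
  have heavy: "card (nbrs E u) \<ge> 5" if "v \<in> T" "u \<in> nbrs E v" for u v
  proof (rule ccontr)
    assume "\<not> ?thesis"
    then have "card (nbrs E u) \<le> 4" by simp
    then show False using contra that by (auto simp: T_def)
  qed
  interpret smoothing V E T
  proof
    show "finite_simple_graph V E" by (rule G)
    show "T \<subseteq> V" by (auto simp: T_def)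
    show "card (nbrs E v) = 2" if "v \<in> T" for v using that by (simp add: T_def)
    show "nbrs E v \<inter> T = {}" if v: "v \<in> T" for v
    proof (rule ccontr)
      assume "nbrs E v \<inter> T \<noteq> {}"
      then obtain u where "u \<in> nbrs E v" "u \<in> T" by auto
      then show False using heavy[OF v, of u] by (simp add: T_def)
    qed
  qed
  have ne': "V - T \<noteq> {}"
  proof
    assume VT: "V - T = {}"
    then obtain v where v: "v \<in> T" using ne by auto
    then have "nbrs E v = {}" using nbrs_T_subset[OF v] VT by auto
    then show False using deg2[OF v] by simp
  qed
  obtain u where u: "u \<in> V - T" "card (nbrs E' u) \<le> 2"
    "nbrs E' u = {} \<or> (\<exists>X\<subseteq>V - T. conn E' X \<and> nbrs E' u \<subseteq> X \<and> u \<notin> X)"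
    using low_noncut_vertex[OF smooth_graph smooth_minor_free[OF mf] ne'] by (elim bexE conjE)
  define N where "N = nbrs E' u"
  define Tu where "Tu = T \<inter> nbrs E u"
  have finN: "finite N" using finite_nbrs[OF smooth_graph] by (simp add: N_def)
  have finTu: "finite Tu" using finite_nbrs[OF G] by (simp add: Tu_def)
  have sub: "nbrs E u \<subseteq> N \<union> Tu"
  proof
    fix w assume w: "w \<in> nbrs E u"
    show "w \<in> N \<union> Tu"
    proof (cases "w \<in> T")
      case True
      then show ?thesis using w by (simp add: Tu_def)
    next
      case False
      have "w \<in> V" using w nbrs_subset[OF G] by auto
      then have "{u, w} \<in> E'" using False w u(1) by (simp add: smooth_edges_def nbrs_def)
      then show ?thesis by (simp add: N_def nbrs_def)
    qed
  qed
  have other: "\<exists>w\<in>N. nbrs E v = {u, w}" if v: "v \<in> Tu" for v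
  proof -
    have vT: "v \<in> T" and "u \<in> nbrs E v" using v nbrs_sym[of u E v] by (simp_all add: Tu_def)
    moreover obtain x y where xy: "nbrs E v = {x, y}" using deg2[OF vT] by (auto simp: card_2_iff)
    ultimately obtain w where w: "nbrs E v = {u, w}" by (auto simp: insert_commute)
    have "{u, w} \<in> E'" using w vT by (auto simp: smooth_edges_def)
    then show ?thesis using w by (auto simp: N_def nbrs_def)
  qed
  have "Tu \<noteq> {}"
  proof
    assume "Tu = {}"
    then have "card (nbrs E u) \<le> card N" using sub finN by (intro card_mono) auto
    then have "card (nbrs E u) = 2" using u(1,2) min2[of u] by (simp add: N_def)
    then show False using u(1) by (simp add: T_def)
  qed
  then obtain v0 where "v0 \<in> T" "v0 \<in> nbrs E u" by (auto simp: Tu_def)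
  then have "card (nbrs E u) \<ge> 5" using heavy[of v0 u] nbrs_sym[of v0 E u] by simp
  moreover have "card (nbrs E u) \<le> card N + card Tu"
    using card_mono[OF _ sub] finN finTu card_Un_le[of N Tu] by simp
  ultimately have Tu3: "card Tu \<ge> 3" using u(2) by (simp add: N_def)
  from other have "\<forall>v\<in>Tu. \<exists>w. w \<in> N \<and> nbrs E v = {u, w}" by auto
  from bchoice[OF this] obtain h where h: "\<forall>v\<in>Tu. h v \<in> N \<and> nbrs E v = {u, h v}" by (elim exE)
  have "h ` Tu \<subseteq> N" using h by auto
  then have hc: "card (h ` Tu) \<le> card N" using finN by (rule card_mono[rotated])
  then have "\<not> inj_on h Tu" using Tu3 u(2) card_image[of h Tu] by (auto simp: N_def)
  then obtain v1 v2 where v: "v1 \<in> Tu" "v2 \<in> Tu" "v1 \<noteq> v2" "h v1 = h v2" by (auto simp: inj_on_def)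
  define w where "w = h v1"
  have w: "w \<in> N" "nbrs E v1 = {u, w}" "nbrs E v2 = {u, w}" using h v by (auto simp: w_def)
  have vT: "v1 \<in> T" "v2 \<in> T" using v by (auto simp: Tu_def)
  have wu: "w \<noteq> u" using deg2[OF vT(1)] w(2) by auto
  show False
  proof (cases "N = {w}")
    case True
    have "Tu - {v1, v2} \<noteq> {}"
    proof
      assume "Tu - {v1, v2} = {}"
      then have "Tu \<subseteq> {v1, v2}" by auto
      then have "card Tu \<le> 2" using card_mono[of "{v1, v2}" Tu] v(3) by simp
      then show False using Tu3 by simp
    qed
    then obtain v3 where v3: "v3 \<in> Tu" "v3 \<noteq> v1" "v3 \<noteq> v2" by auto
    then have n3: "nbrs E v3 = {u, w}" using h True by auto
    have v3T: "v3 \<in> T" using v3 by (auto simp: Tu_def)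
    have uwV: "u \<in> V - T" "w \<in> V - T" using nbrs_T_subset[OF vT(1)] w(2) by auto
    have tv: "touch E {u} {v1}" "touch E {u} {v2}" "touch E {u} {v3}"
      "touch E {w} {v1}" "touch E {w} {v2}" "touch E {w} {v3}"
      using touch_common_nbr[OF w(2)] touch_common_nbr[OF w(3)] touch_common_nbr[OF n3] by simp_all
    have n: "u \<noteq> v1" "u \<noteq> v2" "w \<noteq> v1" "w \<noteq> v2" "u \<noteq> v3" "w \<noteq> v3" using uwV vT v3T by auto
    have inV: "u \<in> V" "w \<in> V" "v1 \<in> V" "v2 \<in> V" "v3 \<in> V" using uwV vT v3T TV by auto
    have "has_minor V E 5 K23"
      by (rule K23_minorI[of "{u}" V "{w}" "{v1}" "{v2}" "{v3}"])
        (use inV n v(3) v3 tv wu in simp_all)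
    then show False using mf by (simp add: minor_free_def)
  next
    case False
    then obtain z where z: "z \<in> N" "z \<noteq> w" using w(1) by auto
    obtain X where X: "X \<subseteq> V - T" "conn E' X" "N \<subseteq> X" "u \<notin> X" using u(3) z(1) by (auto simp: N_def)
    have "z \<in> X" "w \<in> X" using X(3) z w by auto
    from conn_avoid[OF X(2) this z(2)]
    obtain C where C: "C \<subseteq> X - {w}" "conn E' C" "z \<in> C" "touch E' {w} C" by (elim exE conjE)
    have "touch E' {u} C" using z(1) C(3) by (auto simp: N_def touch_singleton_iff)
    then show False using twin_paths_K23[OF mf vT v(3) w(2,3) C(2) _ _ _ _ C(4)] C(1) X(1,4) by auto
  qed
qed

section \<open>Colouring by pairs\<close>

text \<open>A colouring by pairs of colours: disjoint pairs on adjacent vertices, different pairs on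
  vertices with a common neighbour. This is a 2-tone colouring without reference to distances.\<close>

definition pair_coloring :: "nat \<Rightarrow> 'a set \<Rightarrow> 'a set set \<Rightarrow> ('a \<Rightarrow> nat set) \<Rightarrow> bool" where
  "pair_coloring k V E f \<longleftrightarrow>
     (\<forall>v\<in>V. f v \<subseteq> {1..k} \<and> card (f v) = 2) \<and>
     (\<forall>v w. {v, w} \<in> E \<longrightarrow> f v \<inter> f w = {}) \<and>
     (\<forall>v\<in>V. \<forall>w\<in>V. v \<noteq> w \<and> nbrs E v \<inter> nbrs E w \<noteq> {} \<longrightarrow> f v \<noteq> f w)"

text \<open>The pair of \<open>v\<close> has to avoid at most four colours, those on the neighbours of \<open>v\<close>, and the pairs
  of the vertices that have a common neighbour with \<open>v\<close>. The smaller graph must contain an edge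
  between the two neighbours of \<open>v\<close>, as these need different pairs even if \<open>v\<close> is their only
  common neighbour.\<close>

lemma pair_coloring_extend:
  assumes G: "finite_simple_graph V E" and v: "v \<in> V"
    and f: "pair_coloring k (V - {v}) E' f"
    and sub: "\<And>x y. {x, y} \<in> E \<Longrightarrow> x \<noteq> v \<Longrightarrow> y \<noteq> v \<Longrightarrow> {x, y} \<in> E'"
    and nb: "\<And>x y. x \<in> nbrs E v \<Longrightarrow> y \<in> nbrs E v \<Longrightarrow> x \<noteq> y \<Longrightarrow> {x, y} \<in> E'"
    and deg: "card (nbrs E v) \<le> 2"
    and second: "card ((\<Union>x\<in>nbrs E v. nbrs E x) - {v}) < (k - 4) choose 2"
  shows "\<exists>f. pair_coloring k V E f"
proof -
  define N where "N = nbrs E v"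
  define M where "M = (\<Union>x\<in>N. nbrs E x) - {v}"
  have finN: "finite N" and finM: "finite M"
    using finite_nbrs[OF G] by (simp_all add: N_def M_def)
  have vN: "v \<notin> N" using not_nbr_self[OF G] by (simp add: N_def)
  have NV: "N \<subseteq> V - {v}" using nbrs_subset[OF G, of v] vN by (auto simp: N_def)
  have f1: "f x \<subseteq> {1..k} \<and> card (f x) = 2" if "x \<in> V - {v}" for x
    using f that by (simp add: pair_coloring_def)
  have f2: "f x \<inter> f y = {}" if "{x, y} \<in> E'" for x y
    using f that by (simp add: pair_coloring_def)
  have f3: "f x \<noteq> f y" if "x \<in> V - {v}" "y \<in> V - {v}" "x \<noteq> y" "nbrs E' x \<inter> nbrs E' y \<noteq> {}" for x y
    using f that by (simp add: pair_coloring_def)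
  define A where "A = {1..k} - (\<Union>x\<in>N. f x)"
  have finA: "finite A" by (simp add: A_def)
  have fin: "finite (\<Union>x\<in>N. f x)"
  proof (rule finite_subset)
    show "(\<Union>x\<in>N. f x) \<subseteq> {1..k}" using NV f1 by (intro UN_least) auto
  qed simp
  have "card (\<Union>x\<in>N. f x) \<le> (\<Sum>x\<in>N. card (f x))" by (rule card_UN_le[OF finN])
  also have "\<dots> = (\<Sum>x\<in>N. 2)" using f1 NV by (intro sum.cong) auto
  also have "\<dots> \<le> 4" using deg by (simp add: N_def)
  finally have "card (\<Union>x\<in>N. f x) \<le> 4" .
  then have cA: "k - 4 \<le> card A"
    using diff_card_le_card_Diff[OF fin, of "{1..k}"] by (simp add: A_def)
  have "card (f ` M) \<le> card M" by (rule card_image_le[OF finM])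
  also have "\<dots> < (k - 4) choose 2" using second by (simp add: M_def N_def)
  also have "\<dots> \<le> card A choose 2" by (rule binomial_right_mono[OF cA])
  also have "\<dots> = card {B. B \<subseteq> A \<and> card B = 2}" using n_subsets[OF finA, of 2] by simp
  finally have "\<not> {B. B \<subseteq> A \<and> card B = 2} \<subseteq> f ` M"
    using card_mono[of "f ` M" "{B. B \<subseteq> A \<and> card B = 2}"] finM by auto
  then obtain S where S: "S \<subseteq> A" "card S = 2" "S \<notin> f ` M" by auto
  define h where "h = f(v := S)"
  have hv: "h v = S" and hx: "h x = f x" if "x \<noteq> v" for x using that by (simp_all add: h_def)
  have inM: "x \<in> M" if x: "x \<noteq> v" "nbrs E v \<inter> nbrs E x \<noteq> {}" for x
  proof -
    obtain y where "y \<in> nbrs E v" "y \<in> nbrs E x" using x(2) by auto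
    then show ?thesis using x(1) nbrs_sym[of y E x] by (auto simp: M_def N_def)
  qed
  have disj: "S \<inter> f x = {}" if "x \<in> N" for x using S(1) that by (auto simp: A_def)
  have "pair_coloring k V E h"
    unfolding pair_coloring_def
  proof (intro conjI ballI allI impI)
    fix x assume x: "x \<in> V"
    show "h x \<subseteq> {1..k}" "card (h x) = 2"
      using x f1[of x] S(1,2) by (auto simp: h_def A_def)
  next
    fix x y assume e: "{x, y} \<in> E"
    have xy: "x \<noteq> y" using edge_in_graph[OF G e] by simp
    consider "x = v" "y \<noteq> v" | "x \<noteq> v" "y = v" | "x \<noteq> v" "y \<noteq> v" using xy by auto
    then show "h x \<inter> h y = {}"
    proof cases
      case 1
      then have "y \<in> N" using e by (simp add: N_def nbrs_def)
      then show ?thesis using disj[of y] 1 by (simp add: h_def)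
    next
      case 2
      then have "x \<in> N" using e by (simp add: N_def nbrs_def insert_commute)
      then show ?thesis using disj[of x] 2 by (simp add: h_def Int_commute)
    next
      case 3
      then show ?thesis using f2[OF sub[OF e]] by (simp add: h_def)
    qed
  next
    fix x y assume xy: "x \<in> V" "y \<in> V" and n: "x \<noteq> y \<and> nbrs E x \<inter> nbrs E y \<noteq> {}"
    consider "x = v" "y \<noteq> v" | "x \<noteq> v" "y = v" | "x \<noteq> v" "y \<noteq> v" using n by auto
    then show "h x \<noteq> h y"
    proof cases
      case 1
      then have "y \<in> M" using inM[of y] n by simp
      then have "f y \<noteq> S" using S(3) by auto
      then show ?thesis using 1 by (simp add: h_def)
    next
      case 2
      then have "x \<in> M" using inM[of x] n by (simp add: Int_commute)
      then have "f x \<noteq> S" using S(3) by auto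
      then show ?thesis using 2 by (simp add: h_def)
    next
      case 3
      have V: "x \<in> V - {v}" "y \<in> V - {v}" using 3 xy by simp_all
      obtain z where z: "{x, z} \<in> E" "{y, z} \<in> E" using n by (auto simp: nbrs_def)
      have "f x \<noteq> f y"
      proof (cases "z = v")
        case True
        then have "x \<in> nbrs E v" "y \<in> nbrs E v" using z by (simp_all add: nbrs_def insert_commute)
        then have "f x \<inter> f y = {}" using f2[OF nb] n by simp
        moreover have "f x \<noteq> {}" using f1[OF V(1)] by auto
        ultimately show ?thesis by auto
      next
        case False
        then have "{x, z} \<in> E'" "{y, z} \<in> E'" using sub[OF z(1)] sub[OF z(2)] 3 by simp_all
        then show ?thesis using f3[OF V] n by (auto simp: nbrs_def)
      qed
      then show ?thesis using 3 by (simp add: h_def)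
    qed
  qed
  then show ?thesis by (rule exI[of _ h])
qed

text \<open>If every degree is at least 2, the vertex to be smoothed away has a neighbour of degree at most 4
  and another one of degree at most \<open>D\<close>, which leaves at most \<open>3 + (D - 1)\<close> forbidden pairs.\<close>

lemma minor_free_pair_coloring:
  assumes k: "(k - 4) choose 2 \<ge> D + 3"
  shows "finite_simple_graph V E \<Longrightarrow> minor_free V E \<Longrightarrow> (\<And>v. v \<in> V \<Longrightarrow> card (nbrs E v) \<le> D) \<Longrightarrow>
    \<exists>f. pair_coloring k V E f"
proof (induction "card V" arbitrary: V E rule: less_induct)
  case less
  note G = less.prems(1) and mf = less.prems(2)
  have deg: "card (nbrs E x) \<le> D" for x
  proof (cases "x \<in> V")
    case False
    then have "nbrs E x = {}" using edge_in_graph(1)[OF G] by (auto simp: nbrs_def)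
    then show ?thesis by simp
  qed (rule less.prems(3))
  have finV: "finite V" using G by (simp add: finite_simple_graph_def)
  have smaller: "card (V - {v}) < card V" if "v \<in> V" for v
    using that finV by (rule card_Diff1_less[rotated])
  have nbrs_less: "card (nbrs E x - {v}) < card (nbrs E x)" if "x \<in> nbrs E v" for x v
    using that finite_nbrs[OF G, of x] nbrs_sym[of x E v] by (intro card_Diff1_less) simp_all
  consider "V = {}" | v where "v \<in> V" "card (nbrs E v) \<le> 1" | "V \<noteq> {}" "\<forall>v\<in>V. \<not> card (nbrs E v) \<le> 1"
    by blast
  then show ?case
  proof cases
    case 1
    then have "{x, y} \<notin> E" for x y using edge_in_graph(1)[OF G] by auto
    then show ?thesis using 1 by (auto simp: pair_coloring_def)
  next
    case (2 v)
    define E' where "E' = {e \<in> E. v \<notin> e}"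
    have G': "finite_simple_graph (V - {v}) E'"
      using G by (auto simp: finite_simple_graph_def E'_def)
    have mf': "minor_free (V - {v}) E'"
    proof (rule minor_free_contract[OF mf, where F = "\<lambda>x. {x}"])
      fix x y assume "{x, y} \<in> E'"
      then have "{x, y} \<in> E" by (simp add: E'_def)
      then show "touch E {x} {y}" by (rule touchI) simp_all
    qed auto
    have "card (nbrs E' x) \<le> D" for x
    proof -
      have "nbrs E' x \<subseteq> nbrs E x" by (auto simp: nbrs_def E'_def)
      then have "card (nbrs E' x) \<le> card (nbrs E x)" by (rule card_mono[OF finite_nbrs[OF G]])
      then show ?thesis using deg[of x] by simp
    qed
    from less.hyps[OF smaller[OF 2(1)] G' mf' this]
    obtain f where f: "pair_coloring k (V - {v}) E' f" by (elim exE)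
    show ?thesis
    proof (rule pair_coloring_extend[OF G 2(1) f])
      show "{x, y} \<in> E'" if "{x, y} \<in> E" "x \<noteq> v" "y \<noteq> v" for x y
        using that by (auto simp: E'_def)
      show "{x, y} \<in> E'" if "x \<in> nbrs E v" "y \<in> nbrs E v" "x \<noteq> y" for x y
      proof -
        have "card {x, y} \<le> card (nbrs E v)" using that finite_nbrs[OF G] by (intro card_mono) auto
        then show ?thesis using 2(2) that(3) by simp
      qed
      show "card (nbrs E v) \<le> 2" using 2(2) by simp
      have "card ((\<Union>x\<in>nbrs E v. nbrs E x) - {v}) \<le> card (\<Union>x\<in>nbrs E v. nbrs E x)"
        using finite_nbrs[OF G] by (intro card_mono) auto
      also have "\<dots> \<le> (\<Sum>x\<in>nbrs E v. card (nbrs E x))" by (rule card_UN_le[OF finite_nbrs[OF G]])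
      also have "\<dots> \<le> (\<Sum>x\<in>nbrs E v. D)" by (rule sum_mono) (rule deg)
      also have "\<dots> \<le> D" using 2(2) by (cases "card (nbrs E v)") auto
      finally show "card ((\<Union>x\<in>nbrs E v. nbrs E x) - {v}) < (k - 4) choose 2" using k by simp
    qed
  next
    case 3
    have min2: "2 \<le> card (nbrs E v)" if "v \<in> V" for v using bspec[OF 3(2) that] by simp
    have "\<exists>v\<in>V. card (nbrs E v) = 2 \<and> (\<exists>u\<in>nbrs E v. card (nbrs E u) \<le> 4)"
      by (rule degree_two_vertex_with_light_neighbour[OF G mf 3(1) min2])
    then obtain v u where v: "v \<in> V" "card (nbrs E v) = 2" and u: "u \<in> nbrs E v" "card (nbrs E u) \<le> 4"
      by (elim bexE conjE)
    obtain w where w: "nbrs E v = {u, w}" "u \<noteq> w"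
    proof -
      obtain a b where ab: "nbrs E v = {a, b}" "a \<noteq> b" using v(2) by (auto simp: card_2_iff)
      show thesis
      proof (cases "u = a")
        case True
        then show thesis using ab that[of b] by simp
      next
        case False
        then have "u = b" using u(1) ab by simp
        then show thesis using ab that[of a] by (simp add: insert_commute)
      qed
    qed
    have vuw: "v \<noteq> u" "v \<noteq> w" using not_nbr_self[OF G, of v] w(1) by auto
    interpret smoothing V E "{v}"
    proof
      show "nbrs E x \<inter> {v} = {}" if "x \<in> {v}" for x using that not_nbr_self[OF G, of v] by simp
    qed (use G v in simp_all)
    have E': "E' = {e \<in> E. e \<subseteq> V - {v}} \<union> {{u, w}}" by (simp add: smooth_edges_def w(1))
    have vu: "v \<in> nbrs E u" "v \<in> nbrs E w" using w(1) nbrs_sym[of u E v] nbrs_sym[of w E v] by simp_all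
    have "card (nbrs E' x) \<le> D" for x
    proof -
      \<comment> \<open>At \<open>u\<close> and \<open>w\<close> the new edge replaces the edge to \<open>v\<close>.\<close>
      have "card (nbrs E' x) \<le> card (nbrs E x)"
      proof (cases "x = u \<or> x = w")
        case True
        define y where "y = (if x = u then w else u)"
        have "nbrs E' x \<subseteq> insert y (nbrs E x - {v})"
          using True w(2) by (auto simp: nbrs_def E' y_def doubleton_eq_iff)
        then have "card (nbrs E' x) \<le> card (insert y (nbrs E x - {v}))"
          using finite_nbrs[OF G] by (intro card_mono) auto
        also have "\<dots> \<le> Suc (card (nbrs E x - {v}))" by (rule card_insert_le_m1) simp_all
        also have "\<dots> \<le> card (nbrs E x)" using nbrs_less[of x v] True w(1) by auto
        finally show ?thesis .
      next
        case False
        then have "nbrs E' x \<subseteq> nbrs E x" by (auto simp: nbrs_def E' doubleton_eq_iff)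
        then show ?thesis by (rule card_mono[OF finite_nbrs[OF G]])
      qed
      then show ?thesis using deg[of x] by simp
    qed
    from less.hyps[OF smaller[OF v(1)] smooth_graph smooth_minor_free[OF mf] this]
    obtain f where f: "pair_coloring k (V - {v}) E' f" by (elim exE)
    show ?thesis
    proof (rule pair_coloring_extend[OF G v(1) f])
      show "{x, y} \<in> E'" if "{x, y} \<in> E" "x \<noteq> v" "y \<noteq> v" for x y
        using that edge_in_graph[OF G that(1)] by (auto simp: E')
      show "{x, y} \<in> E'" if "x \<in> nbrs E v" "y \<in> nbrs E v" "x \<noteq> y" for x y
        using that w(1) by (auto simp: E' insert_commute)
      show "card (nbrs E v) \<le> 2" using v(2) by simp
      have "(\<Union>x\<in>nbrs E v. nbrs E x) - {v} = (nbrs E u - {v}) \<union> (nbrs E w - {v})"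
        using w(1) by auto
      then have "card ((\<Union>x\<in>nbrs E v. nbrs E x) - {v}) \<le> card (nbrs E u - {v}) + card (nbrs E w - {v})"
        by (simp add: card_Un_le)
      then show "card ((\<Union>x\<in>nbrs E v. nbrs E x) - {v}) < (k - 4) choose 2"
        using nbrs_less[of u v] nbrs_less[of w v] w(1) u(2) deg[of w] k by simp
    qed
  qed
qed

lemma less_graph_distI:
  assumes "\<And>xs. graph_path V E v xs w \<Longrightarrow> n < length xs - 1"
  shows "enat n < graph_dist V E v w"
proof -
  have "enat (Suc n) \<le> graph_dist V E v w"
    unfolding graph_dist_def
  proof (rule INF_greatest)
    fix xs assume "xs \<in> {xs. graph_path V E v xs w}"
    then show "enat (Suc n) \<le> enat (length xs - 1)" using assms[of xs] by simp
  qed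
  then show ?thesis by (simp add: Suc_ile_eq)
qed

lemma pair_coloring_tone_coloring:
  assumes G: "finite_simple_graph V E" and f: "pair_coloring k V E f"
  shows "tone_coloring 2 k V E f"
  unfolding tone_coloring_def
proof (intro conjI ballI impI)
  show "f v \<subseteq> {1..k}" "card (f v) = 2" if "v \<in> V" for v using f that by (simp_all add: pair_coloring_def)
  fix v w assume vw: "v \<in> V" "w \<in> V" "v \<noteq> w"
  have fv: "card (f v) = 2" "card (f w) = 2" using f vw by (simp_all add: pair_coloring_def)
  have fin: "finite (f v)" "finite (f w)" by (rule card_ge_0_finite, simp add: fv)+
  show "enat (card (f v \<inter> f w)) < graph_dist V E v w"
  proof (rule less_graph_distI)
    fix xs assume xs: "graph_path V E v xs w"
    note p = graph_pathD[OF xs]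
    have le2: "card (f v \<inter> f w) \<le> 2" using card_mono[of "f v" "f v \<inter> f w"] fin fv by simp
    consider "xs = [v, w]" | z where "xs = [v, z, w]" | "length xs \<ge> 4"
    proof -
      obtain as where as: "xs = v # as" using p(1,2) by (cases xs) auto
      have "as \<noteq> []" using as p(3) vw(3) by auto
      then obtain b bs where b: "as = b # bs" by (cases as) auto
      show thesis
      proof (cases bs)
        case Nil
        then show thesis using as b p(3) that(1) by simp
      next
        case (Cons c cs)
        show thesis
        proof (cases cs)
          case Nil
          then show thesis using as b Cons p(3) that(2)[of b] by simp
        next
          case (Cons d ds)
          then have "length xs \<ge> 4" using as b \<open>bs = c # cs\<close> by simp
          then show thesis by (rule that(3))
        qed
      qed
    qed
    then show "card (f v \<inter> f w) < length xs - 1"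
    proof cases
      case 1
      then have "{v, w} \<in> E" using p(6) by simp
      then have "f v \<inter> f w = {}" using f by (simp add: pair_coloring_def)
      then show ?thesis using 1 by simp
    next
      case (2 z)
      then have "{v, z} \<in> E" "{z, w} \<in> E" using p(6) by simp_all
      then have "z \<in> nbrs E v \<inter> nbrs E w" by (simp add: nbrs_def insert_commute)
      then have "nbrs E v \<inter> nbrs E w \<noteq> {}" by auto
      moreover have "\<forall>v\<in>V. \<forall>w\<in>V. v \<noteq> w \<and> nbrs E v \<inter> nbrs E w \<noteq> {} \<longrightarrow> f v \<noteq> f w"
        using f unfolding pair_coloring_def by (elim conjE)
      ultimately have ne: "f v \<noteq> f w" using vw by simp
      have "f v = f w" if "f v \<subseteq> f w"
        by (rule card_subset_eq[OF fin(2) that]) (simp add: fv)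
      then have "\<not> f v \<subseteq> f w" using ne by auto
      then have "f v \<inter> f w \<subset> f v" by auto
      from psubset_card_mono[OF fin(1) this] have "card (f v \<inter> f w) < 2" by (simp add: fv)
      then show ?thesis using 2 by simp
    next
      case 3
      then show ?thesis using le2 by simp
    qed
  qed
qed

lemma tone_chromatic_number_le:
  assumes "tone_coloring t k V E f" "k > 0"
  shows "tone_chromatic_number t V E \<le> k"
  unfolding tone_chromatic_number_def by (rule Least_le) (use assms in auto)

lemma outerplanar_tone_chromatic_number_le:
  assumes G: "finite_simple_graph V E" and "outerplanar V E"
    and k: "(k - 4) choose 2 \<ge> max_degree V E + 3"
  shows "tone_chromatic_number 2 V E \<le> k"
proof -
  have deg: "card (nbrs E v) \<le> max_degree V E" if "v \<in> V" for v
  proof -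
    have "finite (insert 0 (vdegree E ` V))" using G by (simp add: finite_simple_graph_def)
    then have "vdegree E v \<le> max_degree V E" unfolding max_degree_def using that by (intro Max_ge) auto
    then show ?thesis by (simp add: vdegree_eq_card_nbrs[OF G])
  qed
  have "\<exists>f. pair_coloring k V E f"
    by (rule minor_free_pair_coloring[OF k G outerplanar_minor_free[OF assms(1,2)] deg])
  then obtain f where "pair_coloring k V E f" by (elim exE)
  moreover have "k > 0" using k by (cases k) (simp_all add: numeral_2_eq_2)
  ultimately show ?thesis
    using tone_chromatic_number_le[OF pair_coloring_tone_coloring[OF G]] by simp
qed

text \<open>Without edges all vertices may receive the same pair. For the last bound in the theorem this case
  is separate: it allows only 6 colours if the maximum degree is 0, which is too few for
  \<open>outerplanar_tone_chromatic_number_le\<close>.\<close>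

lemma edgeless_tone_chromatic_number_le:
  assumes G: "finite_simple_graph V E" and "max_degree V E = 0"
  shows "tone_chromatic_number 2 V E \<le> 2"
proof -
  have E: "E = {}"
  proof (rule ccontr)
    assume "E \<noteq> {}"
    then obtain e where e: "e \<in> E" by auto
    then have "e \<subseteq> V" "card e = 2" using G by (simp_all add: finite_simple_graph_def)
    then obtain x y where xy: "e = {x, y}" "x \<in> V" by (auto simp: card_2_iff)
    have "finite (insert 0 (vdegree E ` V))" using G by (simp add: finite_simple_graph_def)
    then have "vdegree E x \<le> max_degree V E" unfolding max_degree_def using xy by (intro Max_ge) auto
    then have "card (nbrs E x) = 0" using assms(2) vdegree_eq_card_nbrs[OF G, of x] by simp
    then have "nbrs E x = {}" using finite_nbrs[OF G, of x] by simp
    moreover have "y \<in> nbrs E x" using e xy by (simp add: nbrs_def)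
    ultimately show False by simp
  qed
  have "{1..2} = {1, 2::nat}" by auto
  then have "pair_coloring 2 V E (\<lambda>_. {1, 2})" by (simp add: pair_coloring_def E nbrs_def)
  then show ?thesis by (intro tone_chromatic_number_le[OF pair_coloring_tone_coloring[OF G]]) simp_all
qed

text \<open>The bound is the least integer \<open>k\<close> with \<open>(k - 9/2)\<^sup>2 > 2 d + 17/4\<close> above \<open>9/2\<close>, and the inequality
  says that \<open>(k - 4) (k - 5) > 2 d + 4\<close>.\<close>

lemma choose_two_ge:
  fixes d :: nat and k :: int
  assumes k: "k = \<lfloor>sqrt (2 * real d + 4.25) + 5.5\<rfloor>"
  shows "(nat k - 4) choose 2 \<ge> d + 3"
proof -
  define s where "s = sqrt (2 * real d + 4.25)"
  have s2: "s\<^sup>2 = 2 * real d + 4.25" by (simp add: s_def)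
  have s0: "s \<ge> 2" unfolding s_def by (rule real_le_rsqrt) simp
  have "real_of_int k > s + 4.5" using real_of_int_floor_add_one_gt[of "s + 5.5"] unfolding k s_def by linarith
  then have ks: "real_of_int k - 4.5 > s" and k7: "k \<ge> 7" using s0 by linarith+
  define n where "n = nat k - 4"
  have n: "real n = real_of_int k - 4" "n \<ge> 3" using k7 by (simp_all add: n_def of_nat_diff)
  have "s\<^sup>2 < (real n - 1/2)\<^sup>2" using ks s0 n by (intro power_strict_mono) auto
  then have "2 * real d + 4 < real n * (real n - 1)" unfolding s2 by (simp add: power2_eq_square algebra_simps)
  also have "\<dots> = real (n * (n - 1))" using n(2) by (simp add: of_nat_diff)
  finally have "2 * d + 4 < n * (n - 1)" by linarith
  moreover have "even (n * (n - 1))" by (cases "even n") simp_all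
  then have "2 * (n choose 2) = n * (n - 1)" unfolding choose_two by (rule dvd_mult_div_cancel)
  ultimately have "d + 2 < n choose 2" by linarith
  then show ?thesis by (simp add: n_def)
qed

lemma floor_bounds_le:
  fixes d :: nat
  assumes "d \<ge> 1"
  shows "\<lfloor>sqrt (2 * real d + 4.25) + 5.5\<rfloor> \<le> \<lfloor>sqrt (2 * real d) + 6.6\<rfloor>"
proof -
  define s where "s = sqrt (2 * real d)"
  have s2: "s\<^sup>2 = 2 * real d" by (simp add: s_def)
  have "s \<ge> 1.4" unfolding s_def using assms by (intro real_le_rsqrt) (simp add: power2_eq_square)
  then have "2 * real d + 4.25 \<le> (s + 1.1)\<^sup>2" using s2 by (simp add: power2_eq_square algebra_simps)
  then have "sqrt (2 * real d + 4.25) \<le> s + 1.1" using \<open>s \<ge> 1.4\<close> by (intro real_le_lsqrt) auto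
  then show ?thesis unfolding s_def by (intro floor_mono) simp
qed

theorem theorem3p3:
  fixes V :: "'a set" and E :: "'a set set"
  assumes "finite_simple_graph V E"
    and "outerplanar V E"
  shows "int (tone_chromatic_number 2 V E) \<le> \<lfloor>sqrt (2 * real (max_degree V E) + 4.25) + 5.5\<rfloor>
    \<and> (max_degree V E \<ge> 1 \<longrightarrow>
         \<lfloor>sqrt (2 * real (max_degree V E) + 4.25) + 5.5\<rfloor>
           \<le> \<lfloor>sqrt (2 * real (max_degree V E)) + 6.6\<rfloor>)
    \<and> int (tone_chromatic_number 2 V E) \<le> \<lfloor>sqrt (2 * real (max_degree V E)) + 6.6\<rfloor>"
proof -
  define d where "d = max_degree V E"
  define k where "k = \<lfloor>sqrt (2 * real d + 4.25) + 5.5\<rfloor>"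
  have "0 \<le> sqrt (2 * real d + 4.25) + 5.5" by (intro add_nonneg_nonneg) simp_all
  then have "k \<ge> 0" by (simp add: k_def)
  moreover have "tone_chromatic_number 2 V E \<le> nat k"
    using outerplanar_tone_chromatic_number_le[OF assms, of "nat k"] choose_two_ge[OF k_def]
    by (simp add: d_def)
  ultimately have 1: "int (tone_chromatic_number 2 V E) \<le> k" by linarith
  have 2: "k \<le> \<lfloor>sqrt (2 * real d) + 6.6\<rfloor>" if "d \<ge> 1" using floor_bounds_le[OF that] by (simp add: k_def)
  have 3: "int (tone_chromatic_number 2 V E) \<le> \<lfloor>sqrt (2 * real d) + 6.6\<rfloor>"
  proof (cases "d = 0")
    case True
    then have "int (tone_chromatic_number 2 V E) \<le> 2"
      using edgeless_tone_chromatic_number_le[OF assms(1)] by (simp add: d_def)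
    also have "\<dots> \<le> \<lfloor>sqrt (2 * real d) + 6.6\<rfloor>" using True by simp
    finally show ?thesis .
  next
    case False
    then show ?thesis using 1 2 by simp
  qed
  show ?thesis using 1 2 3 unfolding k_def d_def by blast
qed

end
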